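(* Let $\Bbbk$ be a field, let $M\subset R=\Bbbk[x_1,\ldots,x_d]$ and $N\subset S=\Bbbk[y_1,\ldots,y_t]$ be monomial ideals, and suppose that their Betti posets are isomorphic as posets, via an isomorphism $g:B_M\to B_N$. Then a minimal $\mathbb{Z}^d$-graded free resolution of $R/M$ can be relabeled (along $g$) to give the minimal $\mathbb{Z}^t$-graded free resolution of $S/N$.
   Context: The lcm-lattice $L_M$ of a monomial ideal $M$ is the set of all least common multiples of subsets of the minimal monomial generators of $M$, ordered by divisibility, with minimal element $\hat 0=1$. For $p\in L_M$ let $\Delta_p$ be the order complex of the open interval $(\hat 0,p)\subset L_M$; the order complex of an empty poset is $\{\varnothing\}$, whose reduced homology is $\Bbbk$ in degree $-1$. The Betti poset of $M$ (over $\Bbbk$) is the subposet $B_M=\{p\in L_M:\widetilde H_i(\Delta_p,\Bbbk)\ne 0\text{ for some } i\}$; it contains $\hat 0=1$. All multidegrees of basis elements in a minimal $\mathbb Z^d$-graded free resolution of $R/M$ are (exponents of) elements of $B_M$. Relabeling along $g$: let $(\mathcal F_M,\partial^M)$ be a minimal $\mathbb{Z}^d$-graded free resolution of $R/M$ with a chosen homogeneous basis, so that for each basis element $e$ of multidegree $\mathbf a$ one has $\partial^M(e)=\sum_{e'} c_{e,e'}\frac{\mathbf{x}^{\mathbf a}}{\mathbf{x}^{\mathbf a'}}\,e'$, where $e'$ runs over the basis elements in the next lower homological degree, $\mathbf a'$ is the multidegree of $e'$, $c_{e,e'}\in\Bbbk$, and $c_{e,e'}=0$ unless $\mathbf{x}^{\mathbf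 a'}$ divides $\mathbf{x}^{\mathbf a}$. The relabeled sequence $\mathcal F_N$ of free $S$-modules has, for each basis element $e$ of $\mathcal F_M$ of multidegree $\mathbf a$, a basis element $\tilde e$ in the same homological degree whose multidegree is that of the monomial $g(\mathbf x^{\mathbf a})$, and has maps $\partial^N(\tilde e)=\sum_{e'} c_{e,e'}\frac{g(\mathbf{x}^{\mathbf a})}{g(\mathbf{x}^{\mathbf a'})}\,\tilde e'$. The assertion is that $(\mathcal F_N,\partial^N)$ is a minimal free resolution of $S/N$.
   Formalization: It is additionally assumed that M is the unit ideal if and only if N is; otherwise M = R and N = 0 have the same Betti poset {1} although R/M = 0 and S/N = S have different resolutions. *)

theory Defs
  imports Complex_Main "HOL-Library.Poly_Mapping"
begin

section \<open>Monomials and monomial ideals\<close>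

text \<open>
  The polynomial ring over a field \<open>'k\<close> in the variables indexed by a finite type \<open>'x\<close>
  is the monoid algebra \<open>('x \<Rightarrow>\<^sub>0 nat) \<Rightarrow>\<^sub>0 'k\<close>. A monomial is represented by its exponent
  vector, so products of monomials are sums of exponents and the monomial 1 is \<open>0\<close>.
\<close>

type_synonym 'x mono = "'x \<Rightarrow>\<^sub>0 nat"
type_synonym ('x, 'k) mpoly = "('x \<Rightarrow>\<^sub>0 nat) \<Rightarrow>\<^sub>0 'k"

definition monom_poly :: "'x mono \<Rightarrow> ('x, 'k::field) mpoly" where
  "monom_poly m = Poly_Mapping.single m 1"

definition mono_dvd :: "'x mono \<Rightarrow> 'x mono \<Rightarrow> bool" where
  "mono_dvd m n \<longleftrightarrow> (\<forall>x. Poly_Mapping.lookup m x \<le> Poly_Mapping.lookup n x)"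

definition mono_sdvd :: "'x mono \<Rightarrow> 'x mono \<Rightarrow> bool" where
  "mono_sdvd m n \<longleftrightarrow> mono_dvd m n \<and> m \<noteq> n"

definition mono_lcm :: "'x::finite mono set \<Rightarrow> 'x mono" where
  "mono_lcm A =
     Poly_Mapping.Abs_poly_mapping (\<lambda>x. Max (insert 0 ((\<lambda>m. Poly_Mapping.lookup m x) ` A)))"

definition ideal_gen :: "('x, 'k::field) mpoly set \<Rightarrow> ('x, 'k) mpoly set" where
  "ideal_gen = module.span (*)"

definition monomial_ideal :: "('x, 'k::field) mpoly set \<Rightarrow> bool" where
  "monomial_ideal M \<longleftrightarrow> (\<exists>A. M = ideal_gen (monom_poly ` A))"

definition min_gens :: "('x, 'k::field) mpoly set \<Rightarrow> 'x mono set" where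
  "min_gens M = {m. monom_poly m \<in> M \<and> (\<forall>n. monom_poly n \<in> M \<and> mono_dvd n m \<longrightarrow> n = m)}"

text \<open>The ideal generated by the variables.\<close>

definition irrelevant_ideal :: "('x, 'k::field) mpoly set" where
  "irrelevant_ideal = ideal_gen (range (\<lambda>x. monom_poly (Poly_Mapping.single x 1)))"

section \<open>Quotients\<close>

definition coset :: "'a::ab_group_add set \<Rightarrow> 'a \<Rightarrow> 'a set" where
  "coset B z = (\<lambda>b. z + b) ` B"

definition quot :: "'a::ab_group_add set \<Rightarrow> 'a set \<Rightarrow> 'a set set" where
  "quot Z B = coset B ` Z"

section \<open>Order complexes and reduced simplicial homology\<close>

definition order_complex :: "('a \<Rightarrow> 'a \<Rightarrow> bool) \<Rightarrow> 'a set \<Rightarrow> 'a set set" where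
  "order_complex le P = {\<sigma>. finite \<sigma> \<and> \<sigma> \<subseteq> P \<and> (\<forall>a\<in>\<sigma>. \<forall>b\<in>\<sigma>. le a b \<or> le b a)}"

text \<open>
  The simplicial complex \<open>K\<close> contains the empty face, which has dimension \<open>-1\<close>. The strict
  relation \<open>lt\<close> on vertices is meant to be a linear order on every face; it fixes the
  orientations, and hence the signs in the boundary map.
\<close>

definition simplicial_chains :: "'a set set \<Rightarrow> int \<Rightarrow> ('a set \<Rightarrow>\<^sub>0 'k::field) set" where
  "simplicial_chains K i = {c. Poly_Mapping.keys c \<subseteq> {\<sigma>\<in>K. int (card \<sigma>) = i + 1}}"

definition simplicial_boundary ::
    "('a \<Rightarrow> 'a \<Rightarrow> bool) \<Rightarrow> ('a set \<Rightarrow>\<^sub>0 'k::field) \<Rightarrow> ('a set \<Rightarrow>\<^sub>0 'k)" where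
  "simplicial_boundary lt c =
     (\<Sum>\<sigma>\<in>Poly_Mapping.keys c. \<Sum>v\<in>\<sigma>.
        Poly_Mapping.single (\<sigma> - {v}) ((-1) ^ card {u\<in>\<sigma>. lt u v} * Poly_Mapping.lookup c \<sigma>))"

definition simplicial_cycles ::
    "('a \<Rightarrow> 'a \<Rightarrow> bool) \<Rightarrow> 'a set set \<Rightarrow> int \<Rightarrow> ('a set \<Rightarrow>\<^sub>0 'k::field) set" where
  "simplicial_cycles lt K i = {c \<in> simplicial_chains K i. simplicial_boundary lt c = 0}"

definition simplicial_boundaries ::
    "('a \<Rightarrow> 'a \<Rightarrow> bool) \<Rightarrow> 'a set set \<Rightarrow> int \<Rightarrow> ('a set \<Rightarrow>\<^sub>0 'k::field) set" where
  "simplicial_boundaries lt K i = simplicial_boundary lt ` simplicial_chains K (i + 1)"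

definition reduced_homology ::
    "('a \<Rightarrow> 'a \<Rightarrow> bool) \<Rightarrow> 'a set set \<Rightarrow> int \<Rightarrow> ('a set \<Rightarrow>\<^sub>0 'k::field) set set" where
  "reduced_homology lt K i = quot (simplicial_cycles lt K i) (simplicial_boundaries lt K i)"

section \<open>The lcm-lattice and the Betti poset\<close>

definition lcm_lattice :: "('x::finite, 'k::field) mpoly set \<Rightarrow> 'x mono set" where
  "lcm_lattice M = {mono_lcm A | A. A \<subseteq> min_gens M}"

definition lower_complex :: "('x::finite, 'k::field) mpoly set \<Rightarrow> 'x mono \<Rightarrow> 'x mono set set" where
  "lower_complex M p =
     order_complex mono_dvd {q \<in> lcm_lattice M. mono_sdvd 0 q \<and> mono_sdvd q p}"

text \<open>
  A quotient is nonzero iff it differs from the set consisting of the zero coset only. The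
  type annotation makes the coefficients of the homology the field of coefficients of \<open>M\<close>.
  The zero ideal and the unit ideal both have Betti poset \<open>{0}\<close>, i.e. only the monomial 1, although
  their quotients have different resolutions.
\<close>

definition betti_poset :: "('x::finite, 'k::field) mpoly set \<Rightarrow> 'x mono set" where
  "betti_poset M = {p \<in> lcm_lattice M. \<exists>i.
     (reduced_homology mono_sdvd (lower_complex M p) i :: ('x mono set \<Rightarrow>\<^sub>0 'k) set set)
       \<noteq> {simplicial_boundaries mono_sdvd (lower_complex M p) i}}"

definition poset_iso ::
    "('a \<Rightarrow> 'a \<Rightarrow> bool) \<Rightarrow> 'a set \<Rightarrow> ('b \<Rightarrow> 'b \<Rightarrow> bool) \<Rightarrow> 'b set \<Rightarrow> ('a \<Rightarrow> 'b) \<Rightarrow> bool" where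
  "poset_iso le A le' B g \<longleftrightarrow> bij_betw g A B \<and> (\<forall>p\<in>A. \<forall>q\<in>A. le p q \<longleftrightarrow> le' (g p) (g q))"

section \<open>Multigraded free resolutions with a homogeneous basis\<close>

text \<open>
  \<open>basis F i\<close> is the chosen homogeneous basis of the free module in homological degree \<open>i\<close>,
  \<open>mdeg F i e\<close> is the multidegree of \<open>e \<in> basis F i\<close>, and for \<open>i \<ge> 1\<close>,
  \<open>entry F i e e'\<close> is the coefficient of \<open>e' \<in> basis F (i - 1)\<close> in the image of
  \<open>e \<in> basis F i\<close> under the differential. Values outside these bases are irrelevant.
\<close>

record (overloaded) ('b, 'x, 'k::zero) based_seq =
  basis :: "nat \<Rightarrow> 'b set"
  mdeg :: "nat \<Rightarrow> 'b \<Rightarrow> 'x \<Rightarrow> int"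
  entry :: "nat \<Rightarrow> 'b \<Rightarrow> 'b \<Rightarrow> ('x \<Rightarrow>\<^sub>0 nat) \<Rightarrow>\<^sub>0 'k"

definition homogeneous :: "('x \<Rightarrow> int) \<Rightarrow> ('x, 'k::field) mpoly \<Rightarrow> bool" where
  "homogeneous a p \<longleftrightarrow> (\<forall>m\<in>Poly_Mapping.keys p. \<forall>x. int (Poly_Mapping.lookup m x) = a x)"

definition free_mod ::
    "('b, 'x, 'k::field) based_seq \<Rightarrow> nat \<Rightarrow> ('b \<Rightarrow>\<^sub>0 ('x, 'k) mpoly) set" where
  "free_mod F i = {v. Poly_Mapping.keys v \<subseteq> basis F i}"

text \<open>The differential from homological degree \<open>i\<close> to \<open>i - 1\<close>, for \<open>i \<ge> 1\<close>.\<close>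

definition differential ::
    "('b, 'x, 'k::field) based_seq \<Rightarrow> nat \<Rightarrow> ('b \<Rightarrow>\<^sub>0 ('x, 'k) mpoly) \<Rightarrow> ('b \<Rightarrow>\<^sub>0 ('x, 'k) mpoly)" where
  "differential F i v =
     (\<Sum>e\<in>basis F i. \<Sum>e'\<in>basis F (i - 1).
        Poly_Mapping.single e' (Poly_Mapping.lookup v e * entry F i e e'))"

definition graded_free_seq :: "('b, 'x, 'k::field) based_seq \<Rightarrow> bool" where
  "graded_free_seq F \<longleftrightarrow>
     (\<forall>i. finite (basis F i)) \<and>
     (\<forall>i. \<forall>e\<in>basis F (Suc i). \<forall>e'\<in>basis F i.
        homogeneous (\<lambda>x. mdeg F (Suc i) e x - mdeg F i e' x) (entry F (Suc i) e e'))"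

text \<open>
  A homogeneous augmentation from \<open>free_mod F 0\<close> to the quotient by \<open>M\<close> is given by
  homogeneous representatives \<open>\<epsilon> e\<close> of the images of the basis elements.
\<close>

definition augmentation ::
    "('b, 'x, 'k::field) based_seq \<Rightarrow> ('x, 'k) mpoly set \<Rightarrow> ('b \<Rightarrow> ('x, 'k) mpoly)
      \<Rightarrow> ('b \<Rightarrow>\<^sub>0 ('x, 'k) mpoly) \<Rightarrow> ('x, 'k) mpoly set" where
  "augmentation F M \<epsilon> v = coset M (\<Sum>e\<in>basis F 0. Poly_Mapping.lookup v e * \<epsilon> e)"

definition free_resolution :: "('b, 'x, 'k::field) based_seq \<Rightarrow> ('x, 'k) mpoly set \<Rightarrow> bool" where
  "free_resolution F M \<longleftrightarrow>
     graded_free_seq F \<and>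
     (\<exists>\<epsilon>. (\<forall>e\<in>basis F 0. homogeneous (mdeg F 0 e) (\<epsilon> e)) \<and>
          augmentation F M \<epsilon> ` free_mod F 0 = quot UNIV M \<and>
          {v \<in> free_mod F 0. augmentation F M \<epsilon> v = M} = differential F 1 ` free_mod F 1) \<and>
     (\<forall>i. {v \<in> free_mod F (Suc i). differential F (Suc i) v = 0}
            = differential F (Suc (Suc i)) ` free_mod F (Suc (Suc i)))"

definition minimal_free_resolution ::
    "('b, 'x, 'k::field) based_seq \<Rightarrow> ('x, 'k) mpoly set \<Rightarrow> bool" where
  "minimal_free_resolution F M \<longleftrightarrow>
     free_resolution F M \<and>
     (\<forall>i. \<forall>v\<in>free_mod F (Suc i). \<forall>e\<in>basis F i.
        Poly_Mapping.lookup (differential F (Suc i) v) e \<in> irrelevant_ideal)"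

section \<open>Relabeling\<close>

text \<open>The monomial with exponent vector \<open>a\<close>; only meaningful if \<open>a\<close> is nonnegative.\<close>

definition mono_of :: "('x::finite \<Rightarrow> int) \<Rightarrow> 'x mono" where
  "mono_of a = Poly_Mapping.Abs_poly_mapping (\<lambda>x. nat (a x))"

text \<open>
  The scalar \<open>c\<close> with \<open>entry F i e e' = c * x ^ (a - a')\<close>, where \<open>a\<close>, \<open>a'\<close> are the multidegrees of
  \<open>e\<close>, \<open>e'\<close>. Subtraction of exponents is truncated, but if \<open>a'\<close> does not divide \<open>a\<close>
  then the entry is 0 by homogeneity, and so is \<open>c\<close>.
\<close>

definition struct_coeff :: "('b, 'x::finite, 'k::field) based_seq \<Rightarrow> nat \<Rightarrow> 'b \<Rightarrow> 'b \<Rightarrow> 'k" where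
  "struct_coeff F i e e' =
     Poly_Mapping.lookup (entry F i e e') (mono_of (mdeg F i e) - mono_of (mdeg F (i - 1) e'))"

definition relabel ::
    "('x::finite mono \<Rightarrow> 'y mono) \<Rightarrow> ('b, 'x, 'k::field) based_seq \<Rightarrow> ('b, 'y, 'k) based_seq" where
  "relabel g F =
     \<lparr> basis = basis F,
       mdeg = (\<lambda>i e y. int (Poly_Mapping.lookup (g (mono_of (mdeg F i e))) y)),
       entry = (\<lambda>i e e'. Poly_Mapping.single
          (g (mono_of (mdeg F i e)) - g (mono_of (mdeg F (i - 1) e')))
          (struct_coeff F i e e')) \<rparr>"

end

theory Submission
  imports Defs "HOL-Library.Function_Algebras" "HOL-Library.Product_Plus"
begin

text \<open>
  Dropping the monomials from the matrices of a minimal resolution leaves a complex of vector spaces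
  whose basis is labelled by monomials. The resolution property says that for each monomial \<open>a\<close> in the
  ideal the subcomplex of labels dividing \<open>a\<close> is exact. Relabeling changes only the labels, so it
  suffices to check exactness for the new labels, and only for the elements \<open>q \<noteq> 1\<close> of the lcm-lattice
  of \<open>N\<close>. If \<open>q\<close> is in the Betti poset this is the old exactness at the preimage of \<open>q\<close>. Otherwise no
  label equals \<open>q\<close>, and by induction the subcomplexes below all smaller elements are exact. The label
  complex on the open interval \<open>(1, q)\<close> then maps to the chains of the order complex, by iterated coning
  over labels; the mapping cone is exact, because it is exact below every element of the interval,
  and the order complex is acyclic, because \<open>q\<close> is not in the Betti poset. The same comparison shows that the
  labels of a minimal resolution of \<open>R/M\<close> lie in the Betti poset of \<open>M\<close>.
\<close>

text \<open>The induction runs over the whole lcm-lattice of \<open>N\<close>, although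
  \<open>g\<close> only sees the Betti poset, because the order complexes that define the Betti
  poset use all lattice elements below \<open>p\<close>. The lattice suffices because every new
  label lies in it: a label divides a monomial \<open>a\<close> iff it divides the lcm of the
  minimal generators dividing \<open>a\<close>. In multidegrees outside the ideal there is nothing
  to prove, since no label of positive homological degree divides them. The two complexes are
  matched with a shift, homological degree \<open>i\<close> against faces with \<open>i\<close>
  vertices. The only generator in degree 0 has label 1, which is outside the open interval, and
  corresponds to the empty face. The mapping cone is what makes an induction over down-sets
  possible: over the empty down-set each complex alone has homology, while the cone is exact
  there.\<close>

abbreviation "lookup \<equiv> Poly_Mapping.lookup"
abbreviation "keys \<equiv> Poly_Mapping.keys"
abbreviation "single \<equiv> Poly_Mapping.single"

section \<open>Monomials\<close>

interpretation mono_ord: ordering mono_dvd mono_sdvd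
proof
  show "mono_dvd a c" if "mono_dvd a b" "mono_dvd b c" for a b c :: "'a mono"
    using that le_trans unfolding mono_dvd_def by blast
  show "a = b" if "mono_dvd a b" "mono_dvd b a" for a b :: "'a mono"
    using that by (auto simp: mono_dvd_def intro!: poly_mapping_eqI antisym)
qed (auto simp: mono_dvd_def mono_sdvd_def)

lemma mono_dvd_zero [simp]: "mono_dvd 0 m"
  by (simp add: mono_dvd_def)

lemma mono_dvd_zero_iff [simp]: "mono_dvd m 0 \<longleftrightarrow> m = 0"
  by (auto simp: mono_dvd_def intro!: poly_mapping_eqI)

lemma mono_dvd_add: "mono_dvd m (n + m)"
  by (simp add: mono_dvd_def lookup_add)

lemma mono_dvd_diff_add: "mono_dvd m n \<Longrightarrow> n - m + m = n"
  by (rule poly_mapping_eqI) (simp add: mono_dvd_def lookup_add lookup_minus)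

lemma mono_dvd_diff_zero_iff: "mono_dvd m n \<Longrightarrow> n - m = 0 \<longleftrightarrow> n = m"
  using mono_dvd_diff_add[of m n] by auto

lemma mono_diff_diff:
  assumes "mono_dvd l m" "mono_dvd m n"
  shows "n - l - (m - l) = n - m" and "mono_dvd (m - l) (n - l)"
  using assms by (auto intro!: poly_mapping_eqI diff_le_mono simp: mono_dvd_def lookup_minus)

lemma mono_dvd_of_diff:
  assumes "mono_dvd l m" "mono_dvd l n" "mono_dvd (m - l) (n - l)"
  shows "mono_dvd m n"
  unfolding mono_dvd_def
proof
  fix x
  have "lookup l x \<le> lookup m x" "lookup l x \<le> lookup n x"
      "lookup m x - lookup l x \<le> lookup n x - lookup l x"
    using assms by (auto simp: mono_dvd_def lookup_minus)
  then show "lookup m x \<le> lookup n x" by linarith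
qed

text \<open>Total degree is the measure; it is finite because there are finitely many variables. The
  inductions on labels and on lattice elements rest on this.\<close>

lemma wf_mono_sdvd: "wfp (mono_sdvd :: 'x::finite mono \<Rightarrow> 'x mono \<Rightarrow> bool)"
proof (rule wfp_if_convertible_to_nat)
  fix m n :: "'x mono"
  assume mn: "mono_sdvd m n"
  have "(\<forall>x. lookup m x \<le> lookup n x) \<and> (\<exists>x. lookup m x \<noteq> lookup n x)"
    using mn by (auto simp: mono_sdvd_def mono_dvd_def poly_mapping_eq_iff fun_eq_iff)
  then show "(\<Sum>x\<in>UNIV. lookup m x) < (\<Sum>x\<in>UNIV. lookup n x)"
    by (intro sum_strict_mono_ex1) (auto intro: le_neq_implies_less)
qed

subsection \<open>Dickson's lemma\<close>

text \<open>If the monotone subsequence decreases, it is constant from the place where its least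
  value is attained, so a shift of the index makes it increasing.\<close>

lemma nat_seq_incseq_subseq:
  fixes u :: "nat \<Rightarrow> nat"
  shows "\<exists>r :: nat \<Rightarrow> nat. strict_mono r \<and> incseq (u \<circ> r)"
proof -
  obtain f where f: "strict_mono (f :: nat \<Rightarrow> nat)" "monoseq (\<lambda>n. u (f n))"
    using seq_monosub by blast
  show ?thesis
  proof (cases "incseq (\<lambda>n. u (f n))")
    case True
    then show ?thesis using f by (auto simp: o_def)
  next
    case False
    then have dec: "decseq (\<lambda>n. u (f n))" using f monoseq_iff by blast
    define v where "v = (LEAST k. k \<in> range (\<lambda>n. u (f n)))"
    have "v \<in> range (\<lambda>n. u (f n))"
      unfolding v_def by (rule LeastI) auto
    then obtain m where m: "v = u (f m)" by auto
    have "u (f (n + m)) = v" for n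
    proof (rule antisym)
      show "u (f (n + m)) \<le> v" using dec m by (simp add: decseq_def)
      show "v \<le> u (f (n + m))" unfolding v_def by (rule Least_le) auto
    qed
    then have "incseq (u \<circ> (\<lambda>n. f (n + m)))" by (simp add: incseq_def)
    moreover have "strict_mono (\<lambda>n. f (n + m))" using f(1) by (simp add: strict_mono_def)
    ultimately show ?thesis by blast
  qed
qed

text \<open>Pass to a further subsequence once per coordinate; coordinates already treated stay
  increasing.\<close>

lemma coordinatewise_incseq_subseq:
  fixes s :: "nat \<Rightarrow> 'x \<Rightarrow> nat"
  assumes "finite X"
  shows "\<exists>r :: nat \<Rightarrow> nat. strict_mono r \<and> (\<forall>x\<in>X. incseq (\<lambda>n. s (r n) x))"
  using assms
proof (induction X)
  case empty
  then show ?case using strict_mono_id by blast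
next
  case (insert x X)
  then obtain r where r: "strict_mono (r :: nat \<Rightarrow> nat)" "\<forall>x\<in>X. incseq (\<lambda>n. s (r n) x)" by blast
  obtain r' where r': "strict_mono (r' :: nat \<Rightarrow> nat)" "incseq ((\<lambda>n. s (r n) x) \<circ> r')"
    using nat_seq_incseq_subseq by blast
  have "strict_mono (r \<circ> r')" using r(1) r'(1) by (rule strict_mono_o)
  moreover have "incseq (\<lambda>n. s ((r \<circ> r') n) y)" if "y \<in> insert x X" for y
    using that r(2) r' by (auto simp: incseq_def o_def strict_mono_less_eq)
  ultimately show ?case by blast
qed

text \<open>An infinite antichain would contain an injective sequence, and two terms of a
  coordinatewise increasing subsequence are comparable. This makes the set of minimal generators
  finite.\<close>

lemma finite_mono_antichain:
  fixes A :: "'x::finite mono set"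
  assumes "\<And>m n. m \<in> A \<Longrightarrow> n \<in> A \<Longrightarrow> mono_dvd m n \<Longrightarrow> m = n"
  shows "finite A"
proof (rule ccontr)
  assume "infinite A"
  then obtain s :: "nat \<Rightarrow> 'x mono" where s: "inj s" "range s \<subseteq> A"
    using infinite_countable_subset by blast
  obtain r :: "nat \<Rightarrow> nat" where r: "strict_mono r" "\<forall>x\<in>UNIV. incseq (\<lambda>n. lookup (s (r n)) x)"
    using coordinatewise_incseq_subseq[of UNIV "\<lambda>n. lookup (s n)"] by auto
  have "mono_dvd (s (r 0)) (s (r 1))"
    using r(2) by (simp add: mono_dvd_def incseq_def)
  then have "s (r 0) = s (r 1)" using assms s(2) by blast
  then show False using s(1) r(1) by (metis injD strict_mono_less less_irrefl zero_less_one)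
qed

subsection \<open>Least common multiples\<close>

lemma lookup_mono_lcm:
  "lookup (mono_lcm A) x = Max (insert 0 ((\<lambda>m. lookup m x) ` A))"
  unfolding mono_lcm_def by (subst lookup_Abs_poly_mapping) auto

lemma dvd_mono_lcm: "finite A \<Longrightarrow> m \<in> A \<Longrightarrow> mono_dvd m (mono_lcm A)"
  by (auto simp: mono_dvd_def lookup_mono_lcm intro!: Max_ge)

lemma mono_lcm_dvd: "finite A \<Longrightarrow> (\<And>m. m \<in> A \<Longrightarrow> mono_dvd m n) \<Longrightarrow> mono_dvd (mono_lcm A) n"
  by (auto simp: mono_dvd_def lookup_mono_lcm)

lemma mono_lcm_empty [simp]: "mono_lcm {} = 0"
  by (rule poly_mapping_eqI) (simp add: lookup_mono_lcm)

section \<open>Monomial ideals\<close>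

lemma poly_mapping_sum_single: "(\<Sum>m\<in>keys p. single m (lookup p m)) = p"
  by (rule poly_mapping_eqI) (auto simp: lookup_sum lookup_single when_def sum.delta in_keys_iff)

lemma lookup_times_single:
  fixes p :: "('x, 'k::field) mpoly"
  shows "lookup (p * single m c) n = (if mono_dvd m n then lookup p (n - m) * c else 0)"
proof -
  have "(\<Sum>k\<in>keys p. single k (lookup p k)) * single m c
      = (\<Sum>k\<in>keys p. single (k + m) (lookup p k * c))"
    by (simp add: sum_distrib_right mult_single)
  then have *: "lookup (p * single m c) n = (\<Sum>k\<in>keys p. if k + m = n then lookup p k * c else 0)"
    by (simp add: poly_mapping_sum_single lookup_sum lookup_single when_def)
  show ?thesis
  proof (cases "mono_dvd m n")
    case True
    have "k + m = n \<longleftrightarrow> k = n - m" for k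
      using mono_dvd_diff_add[OF True] by auto
    then show ?thesis using True unfolding * by (auto simp: sum.delta in_keys_iff)
  next
    case False
    then have "k + m \<noteq> n" for k using mono_dvd_add by blast
    then show ?thesis using False unfolding * by simp
  qed
qed

interpretation mpoly_module: module "(*) :: ('x, 'k::field) mpoly \<Rightarrow> _"
  by unfold_locales (auto simp: algebra_simps)

text \<open>Membership becomes a condition on the support: sums and multiples create only multiples
  of monomials already present, and conversely each term is a multiple of one generator.\<close>

lemma ideal_gen_monom_poly:
  "ideal_gen (monom_poly ` A :: ('x, 'k::field) mpoly set) = {p. \<forall>m\<in>keys p. \<exists>a\<in>A. mono_dvd a m}"
  (is "_ = ?I")
proof
  have sub: "mpoly_module.subspace ?I"
  proof (rule mpoly_module.subspaceI)
    fix p q assume "p \<in> ?I" "q \<in> ?I"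
    then show "p + q \<in> ?I" using keys_add[of p q] by auto
  next
    fix c p :: "('x, 'k) mpoly" assume p: "p \<in> ?I"
    show "c * p \<in> ?I"
    proof safe
      fix m assume "m \<in> keys (c * p)"
      then obtain k n where m: "m = k + n" "n \<in> keys p"
        using keys_mult[of c p] by auto
      then obtain a where "a \<in> A" "mono_dvd a n" using p by auto
      then show "\<exists>a\<in>A. mono_dvd a m"
        using mono_ord.trans[of a n m] mono_dvd_add[of n k] m(1) by auto
    qed
  qed auto
  have base: "monom_poly ` A \<subseteq> ?I"
  proof
    fix p :: "('x, 'k) mpoly" assume "p \<in> monom_poly ` A"
    then obtain a where a: "a \<in> A" "p = single a 1" by (auto simp: monom_poly_def)
    have "mono_dvd a a" by (rule mono_ord.refl)
    then show "p \<in> ?I" using a by auto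
  qed
  show "ideal_gen (monom_poly ` A) \<subseteq> ?I"
    using mpoly_module.span_minimal[OF base sub] by (simp only: ideal_gen_def)
next
  show "?I \<subseteq> ideal_gen (monom_poly ` A)"
  proof
    fix p :: "('x, 'k) mpoly" assume p: "p \<in> ?I"
    have "single m (lookup p m) \<in> ideal_gen (monom_poly ` A)" if m: "m \<in> keys p" for m
    proof -
      obtain a where a: "a \<in> A" "mono_dvd a m" using p m by blast
      have "single m (lookup p m) = single (m - a) (lookup p m) * monom_poly a"
        using mono_dvd_diff_add[OF a(2)] by (simp add: monom_poly_def mult_single)
      then show ?thesis
        using a(1) unfolding ideal_gen_def by (simp add: mpoly_module.span_scale mpoly_module.span_base)
    qed
    then have "(\<Sum>m\<in>keys p. single m (lookup p m)) \<in> ideal_gen (monom_poly ` A)"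
      unfolding ideal_gen_def by (intro mpoly_module.span_sum)
    then show "p \<in> ideal_gen (monom_poly ` A)" by (simp add: poly_mapping_sum_single)
  qed
qed

text \<open>Every monomial other than 1 is divisible by a variable, so minimality turns into the
  vanishing of constant terms.\<close>

lemma irrelevant_ideal_iff:
  fixes p :: "('x, 'k::field) mpoly"
  shows "p \<in> irrelevant_ideal \<longleftrightarrow> lookup p 0 = 0"
proof -
  have "(\<exists>x. mono_dvd (single x 1) m) \<longleftrightarrow> m \<noteq> 0" for m :: "'x mono"
  proof
    assume "m \<noteq> 0"
    then obtain x where "lookup m x \<noteq> 0" by (metis poly_mapping_eqI lookup_zero)
    then show "\<exists>x. mono_dvd (single x 1) m"
      by (auto simp: mono_dvd_def lookup_single when_def intro!: exI[of _ x])
  next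
    assume "\<exists>x. mono_dvd (single x 1) m"
    then obtain x where "lookup (single x (1 :: nat)) x \<le> lookup m x"
      unfolding mono_dvd_def by blast
    then show "m \<noteq> 0" by auto
  qed
  moreover have "irrelevant_ideal = ideal_gen (monom_poly ` range (\<lambda>x. single x 1) :: ('x, 'k) mpoly set)"
    by (simp add: irrelevant_ideal_def image_image)
  ultimately have "irrelevant_ideal = {p :: ('x, 'k) mpoly. 0 \<notin> keys p}"
    by (auto simp: ideal_gen_monom_poly)
  then have "p \<in> irrelevant_ideal \<longleftrightarrow> p \<in> {p :: ('x, 'k) mpoly. 0 \<notin> keys p}" by (rule arg_cong)
  then show ?thesis by (simp add: in_keys_iff)
qed

text \<open>The largest element of the lcm-lattice dividing \<open>a\<close>; it replaces arbitrary
  multidegrees by lattice elements. If no generator divides \<open>a\<close>, it is 1.\<close>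

definition lcm_below :: "('x::finite, 'k::field) mpoly set \<Rightarrow> 'x mono \<Rightarrow> 'x mono" where
  "lcm_below M a = mono_lcm {m \<in> min_gens M. mono_dvd m a}"

section \<open>Membership, minimal generators and lcms for a fixed monomial ideal\<close>

context
  fixes M :: "('x::finite, 'k::field) mpoly set"
  assumes M: "monomial_ideal M"
begin

lemma monomial_ideal_iff: "p \<in> M \<longleftrightarrow> (\<forall>m\<in>keys p. monom_poly m \<in> M)"
proof -
  obtain A where "M = {p. \<forall>m\<in>keys p. \<exists>a\<in>A. mono_dvd a m}"
    using M by (auto simp: monomial_ideal_def ideal_gen_monom_poly)
  then show ?thesis by (simp add: monom_poly_def)
qed

lemma monomial_ideal_dvd: "monom_poly m \<in> M \<Longrightarrow> mono_dvd m n \<Longrightarrow> monom_poly n \<in> M"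
proof -
  assume mn: "monom_poly m \<in> M" "mono_dvd m n"
  obtain A where M: "M = {p. \<forall>m\<in>keys p. \<exists>a\<in>A. mono_dvd a m}"
    using M by (auto simp: monomial_ideal_def ideal_gen_monom_poly)
  then have "\<exists>a\<in>A. mono_dvd a m" using mn(1) by (simp add: monom_poly_def)
  then have "\<exists>a\<in>A. mono_dvd a n" using mn(2) mono_ord.trans by blast
  with M show ?thesis by (simp add: monom_poly_def)
qed

lemma monomial_ideal_single: "c \<noteq> 0 \<Longrightarrow> single m c \<in> M \<longleftrightarrow> monom_poly m \<in> M"
  by (subst monomial_ideal_iff) simp

lemma monomial_ideal_diff: "p \<in> M \<Longrightarrow> q \<in> M \<Longrightarrow> p - q \<in> M"
  using keys_diff[of p q] monomial_ideal_iff[of p] monomial_ideal_iff[of q]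
  by (subst monomial_ideal_iff) blast

lemma monomial_ideal_zero: "0 \<in> M"
  by (subst monomial_ideal_iff) simp

lemma monomial_ideal_one_iff: "monom_poly 0 \<in> M \<longleftrightarrow> M = UNIV"
proof
  assume "monom_poly 0 \<in> M"
  then have "p \<in> M" for p
    by (subst monomial_ideal_iff) (auto intro: monomial_ideal_dvd)
  then show "M = UNIV" by blast
qed simp

lemma finite_min_gens: "finite (min_gens M)"
  by (rule finite_mono_antichain) (auto simp: min_gens_def)

text \<open>Descent: a monomial of the ideal that is not minimal has a proper divisor in the
  ideal.\<close>

lemma ex_min_gens_dvd:
  assumes "monom_poly m \<in> M"
  shows "\<exists>n\<in>min_gens M. mono_dvd n m"
  using assms
proof (induction m rule: wfp_induct_rule[OF wf_mono_sdvd])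
  case (1 m)
  show ?case
  proof (cases "m \<in> min_gens M")
    case True
    then show ?thesis using mono_ord.refl by blast
  next
    case False
    then obtain n where "monom_poly n \<in> M" "mono_dvd n m" "n \<noteq> m"
      using 1(2) by (auto simp: min_gens_def)
    then obtain l where "l \<in> min_gens M" "mono_dvd l n"
      using 1(1)[of n] by (auto simp: mono_sdvd_def)
    then show ?thesis using \<open>mono_dvd n m\<close> mono_ord.trans by blast
  qed
qed

lemma lcm_lattice_zero: "0 \<in> lcm_lattice M"
  unfolding lcm_lattice_def using mono_lcm_empty by (metis (mono_tags, lifting) CollectI empty_subsetI)

lemma finite_lcm_lattice: "finite (lcm_lattice M)"
proof -
  have "lcm_lattice M = mono_lcm ` Pow (min_gens M)"
    by (auto simp: lcm_lattice_def)
  then show ?thesis using finite_min_gens by simp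
qed

text \<open>\<open>0\<close> stands for the monomial 1, the lcm of the empty set; any other lattice
  element is a multiple of some generator.\<close>

lemma lcm_lattice_in_ideal:
  assumes "p \<in> lcm_lattice M" "p \<noteq> 0"
  shows "monom_poly p \<in> M"
proof -
  obtain A where A: "A \<subseteq> min_gens M" "p = mono_lcm A"
    using assms by (auto simp: lcm_lattice_def)
  then obtain m where "m \<in> A" using assms(2) by fastforce
  then have "mono_dvd m p" "monom_poly m \<in> M"
    using A finite_min_gens dvd_mono_lcm[of A m] by (auto simp: min_gens_def dest: finite_subset)
  then show ?thesis using monomial_ideal_dvd by blast
qed

lemma lcm_below_lcm_lattice: "lcm_below M a \<in> lcm_lattice M"
  by (auto simp: lcm_below_def lcm_lattice_def)

lemma lcm_below_dvd: "mono_dvd (lcm_below M a) a"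
  unfolding lcm_below_def using finite_min_gens by (intro mono_lcm_dvd) auto

text \<open>Each generator entering the lcm \<open>p\<close> divides \<open>a\<close>, hence is
  among those whose lcm is \<open>lcm_below M a\<close>.\<close>

lemma dvd_lcm_below:
  assumes "p \<in> lcm_lattice M" "mono_dvd p a"
  shows "mono_dvd p (lcm_below M a)"
proof -
  obtain A where A: "A \<subseteq> min_gens M" "p = mono_lcm A"
    using assms by (auto simp: lcm_lattice_def)
  have fin: "finite A" using A finite_min_gens finite_subset by blast
  show ?thesis unfolding A(2)
  proof (rule mono_lcm_dvd[OF fin])
    fix m assume m: "m \<in> A"
    then have "mono_dvd m a" using dvd_mono_lcm[OF fin m] A assms(2) mono_ord.trans by blast
    then show "mono_dvd m (lcm_below M a)"
      unfolding lcm_below_def using m A finite_min_gens by (intro dvd_mono_lcm) auto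
  qed
qed

lemma lcm_below_in_ideal:
  assumes "monom_poly a \<in> M"
  shows "monom_poly (lcm_below M a) \<in> M"
proof -
  obtain n where n: "n \<in> min_gens M" "mono_dvd n a" using ex_min_gens_dvd[OF assms] by blast
  have "mono_dvd n (lcm_below M a)"
    unfolding lcm_below_def using n finite_min_gens by (intro dvd_mono_lcm) auto
  moreover have "monom_poly n \<in> M" using n by (simp add: min_gens_def)
  ultimately show ?thesis using monomial_ideal_dvd by blast
qed

end

section \<open>Additive maps on finitely supported functions\<close>

text \<open>Cancellation can make the support of a sum smaller than the union of the supports, so
  all three sums are extended to that union, where the extra terms are zero.\<close>

lemma additive_sum_keys:
  fixes \<phi> :: "'a \<Rightarrow> 'k::ab_group_add \<Rightarrow> 'v::ab_group_add"
  assumes "\<And>a. additive (\<phi> a)"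
  shows "additive (\<lambda>v. \<Sum>a\<in>keys v. \<phi> a (lookup v a))"
proof
  fix v w :: "'a \<Rightarrow>\<^sub>0 'k"
  have *: "(\<Sum>a\<in>keys u. \<phi> a (lookup u a)) = (\<Sum>a\<in>keys v \<union> keys w. \<phi> a (lookup u a))"
    if "keys u \<subseteq> keys v \<union> keys w" for u
    using that additive.zero[OF assms] by (intro sum.mono_neutral_left) (auto simp: in_keys_iff)
  show "(\<Sum>a\<in>keys (v + w). \<phi> a (lookup (v + w) a))
      = (\<Sum>a\<in>keys v. \<phi> a (lookup v a)) + (\<Sum>a\<in>keys w. \<phi> a (lookup w a))"
    unfolding *[OF keys_add] *[OF Un_upper1] *[OF Un_upper2]
    by (simp add: lookup_add additive.add[OF assms] sum.distrib)
qed

lemma additive_sum_single: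
  assumes "additive f"
  shows "f v = (\<Sum>a\<in>keys v. f (single a (lookup v a)))"
  using additive.sum[OF assms, of "\<lambda>a. single a (lookup v a)" "keys v"]
  by (simp add: poly_mapping_sum_single)

text \<open>The elements \<open>single a k\<close> with arbitrary \<open>k\<close> generate
  additively, so additivity stands in for linearity and no scalar multiplication has to be set
  up.\<close>

lemma additive_eqI_single:
  assumes "additive f" "additive g"
    and "\<And>a. a \<in> keys v \<Longrightarrow> f (single a (lookup v a)) = g (single a (lookup v a))"
  shows "f v = g v"
  using assms(3) by (simp add: additive_sum_single[OF assms(1), of v] additive_sum_single[OF assms(2), of v])

lemma keys_sum_subset:
  fixes f :: "'i \<Rightarrow> 'a \<Rightarrow>\<^sub>0 'k::comm_monoid_add"
  assumes "\<And>i. i \<in> I \<Longrightarrow> keys (f i) \<subseteq> T"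
  shows "keys (sum f I) \<subseteq> T"
  using assms by (induction I rule: infinite_finite_induct) (auto dest!: subsetD[OF keys_add])

text \<open>Supplies the splitting of chains in the Mayer--Vietoris step; keys in both sets go to
  the first summand.\<close>

lemma poly_mapping_split:
  fixes v :: "'a \<Rightarrow>\<^sub>0 'k::comm_monoid_add"
  assumes "keys v \<subseteq> S \<union> T"
  shows "\<exists>x y. v = x + y \<and> keys x \<subseteq> S \<and> keys y \<subseteq> T"
proof (intro exI conjI)
  let ?x = "\<Sum>a\<in>keys v \<inter> S. single a (lookup v a)"
  let ?y = "\<Sum>a\<in>keys v - S. single a (lookup v a)"
  have "(\<Sum>a\<in>keys v. single a (lookup v a)) = ?x + ?y"
    by (rule sum.Int_Diff) simp
  then show "v = ?x + ?y" by (simp add: poly_mapping_sum_single)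
  show "keys ?x \<subseteq> S" "keys ?y \<subseteq> T"
    by (rule keys_sum_subset; use assms in auto)+
qed

lemma keys_additive_subset:
  assumes "additive f" "\<And>a. a \<in> keys v \<Longrightarrow> keys (f (single a (lookup v a))) \<subseteq> T"
  shows "keys (f v) \<subseteq> T"
  unfolding additive_sum_single[OF assms(1), of v] using assms(2) by (rule keys_sum_subset)

lemma additive_compose: "additive f \<Longrightarrow> additive g \<Longrightarrow> additive (\<lambda>x. f (g x))"
  by (simp add: additive_def)

section \<open>Simplicial chains and cones\<close>

lemma additive_simplicial_boundary: "additive (simplicial_boundary lt)"
  unfolding simplicial_boundary_def
  by (rule additive_sum_keys)
    (simp add: additive_def distrib_left single_add sum.distrib)

lemma simplicial_boundary_single:
  "simplicial_boundary lt (single \<sigma> k)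
    = (\<Sum>v\<in>\<sigma>. single (\<sigma> - {v}) ((-1) ^ card {u\<in>\<sigma>. lt u v} * k))"
  by (cases "k = 0") (simp_all add: simplicial_boundary_def)

lemma simplicial_boundary_zero [simp]: "simplicial_boundary lt 0 = 0"
  by (rule additive.zero[OF additive_simplicial_boundary])

text \<open>
  The boundary map counts the vertices below the removed one, so joining with an apex above all
  vertices of \<open>\<sigma>\<close> needs the sign \<open>(-1) ^ card \<sigma>\<close>.
\<close>

definition cone :: "'a \<Rightarrow> ('a set \<Rightarrow>\<^sub>0 'k::field) \<Rightarrow> ('a set \<Rightarrow>\<^sub>0 'k)" where
  "cone p c = (\<Sum>\<sigma>\<in>keys c. if p \<in> \<sigma> then 0 else single (insert p \<sigma>) ((-1) ^ card \<sigma> * lookup c \<sigma>))"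

lemma additive_cone: "additive (cone p)"
  unfolding cone_def
  by (rule additive_sum_keys[where \<phi> = "\<lambda>\<sigma> k. if p \<in> \<sigma> then 0 else single (insert p \<sigma>) ((-1) ^ card \<sigma> * k)"])
    (simp add: additive_def distrib_left single_add)

lemma cone_single:
  "cone p (single \<sigma> k) = (if p \<in> \<sigma> then 0 else single (insert p \<sigma>) ((-1) ^ card \<sigma> * k))"
  by (cases "k = 0") (simp_all add: cone_def)

text \<open>The cone is a contracting homotopy. If the apex is outside \<sigma>, removing it gives
  back \<sigma> with a squared sign, and the remaining terms of the two summands carry the signs of
  \<open>card \<sigma>\<close> and \<open>card \<sigma> - 1\<close>, so they cancel. If it is in
  \<sigma>, the first summand vanishes and only the face without the apex survives in the
  second.\<close>

lemma (in ordering) boundary_cone_single: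
  assumes fin: "finite \<sigma>" and le: "\<And>u. u \<in> \<sigma> \<Longrightarrow> u \<^bold>\<le> p"
  shows "simplicial_boundary (\<^bold><) (cone p (single \<sigma> k)) + cone p (simplicial_boundary (\<^bold><) (single \<sigma> k))
    = single \<sigma> (k :: 'k::field)"
proof (cases "p \<in> \<sigma>")
  case False
  have below_p: "{u \<in> insert p \<sigma>. u \<^bold>< p} = \<sigma>"
    using le False by (auto simp: strict_iff_order)
  \<comment> \<open>The apex lies above every vertex, so adding it leaves the signs at the other
    vertices unchanged.\<close>
  have below_v: "{u \<in> insert p \<sigma>. u \<^bold>< v} = {u \<in> \<sigma>. u \<^bold>< v}" if "v \<in> \<sigma>" for v
    using le[OF that] False that by (auto simp: strict_iff_order dest: antisym)
  have diff: "insert p \<sigma> - {v} = insert p (\<sigma> - {v})" if "v \<in> \<sigma>" for v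
    using that False by auto
  define s :: "'a \<Rightarrow> 'k" where "s v = (-1) ^ card {u \<in> \<sigma>. u \<^bold>< v} * k" for v
  have "simplicial_boundary (\<^bold><) (cone p (single \<sigma> k))
      = single \<sigma> k + (\<Sum>v\<in>\<sigma>. single (insert p (\<sigma> - {v})) ((-1) ^ card \<sigma> * s v))"
  proof -
    have "(\<Sum>v\<in>\<sigma>. single (insert p \<sigma> - {v}) ((-1) ^ card {u \<in> insert p \<sigma>. u \<^bold>< v} * ((-1) ^ card \<sigma> * k)))
        = (\<Sum>v\<in>\<sigma>. single (insert p (\<sigma> - {v})) ((-1) ^ card \<sigma> * s v))"
    proof (rule sum.cong[OF HOL.refl])
      fix v assume v: "v \<in> \<sigma>"
      show "single (insert p \<sigma> - {v}) ((-1) ^ card {u \<in> insert p \<sigma>. u \<^bold>< v} * ((-1) ^ card \<sigma> * k))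
          = single (insert p (\<sigma> - {v})) ((-1) ^ card \<sigma> * s v)"
        unfolding below_v[OF v] diff[OF v] s_def by (simp only: mult.left_commute)
    qed
    moreover have "(-1) ^ card \<sigma> * ((-1) ^ card \<sigma> * k) = k"
      by (simp add: mult.assoc[symmetric] power_mult_distrib[symmetric])
    ultimately show ?thesis
      using False fin
      unfolding cone_single simplicial_boundary_single if_not_P[OF False] sum.insert[OF fin False] below_p
      by simp
  qed
  moreover have "cone p (simplicial_boundary (\<^bold><) (single \<sigma> k))
      = (\<Sum>v\<in>\<sigma>. single (insert p (\<sigma> - {v})) ((-1) ^ (card \<sigma> - 1) * s v))"
    using False fin
    by (simp add: simplicial_boundary_single additive.sum[OF additive_cone] cone_single s_def)
  moreover have "single (insert p (\<sigma> - {v})) ((-1) ^ card \<sigma> * s v)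
      + single (insert p (\<sigma> - {v})) ((-1) ^ (card \<sigma> - 1) * s v) = 0" if "v \<in> \<sigma>" for v
  proof -
    have "card \<sigma> = Suc (card \<sigma> - 1)" using that fin by (metis card_Suc_Diff1 diff_Suc_1)
    then have "(-1 :: 'k) ^ card \<sigma> = - ((-1) ^ (card \<sigma> - 1))" by (metis power_Suc mult_minus1)
    then show ?thesis by (simp add: single_add[symmetric])
  qed
  ultimately show ?thesis
    by (simp add: sum.distrib[symmetric] add.assoc)
next
  case True
  have below_p: "{u \<in> \<sigma>. u \<^bold>< p} = \<sigma> - {p}"
    using le by (auto simp: strict_iff_order)
  have "cone p (simplicial_boundary (\<^bold><) (single \<sigma> k))
      = (\<Sum>v\<in>\<sigma>. if v = p then single \<sigma> k else 0)"
    unfolding simplicial_boundary_single additive.sum[OF additive_cone]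
  proof (intro sum.cong HOL.refl)
    fix v assume "v \<in> \<sigma>"
    show "cone p (single (\<sigma> - {v}) ((-1) ^ card {u \<in> \<sigma>. u \<^bold>< v} * k)) = (if v = p then single \<sigma> k else 0)"
      using True by (auto simp: cone_single below_p insert_absorb mult.assoc[symmetric] power_mult_distrib[symmetric])
  qed
  also have "\<dots> = single \<sigma> k"
    using True fin by simp
  finally show ?thesis using True by (simp add: cone_single)
qed

lemma (in ordering) boundary_cone:
  assumes "\<And>\<sigma>. \<sigma> \<in> keys c \<Longrightarrow> finite \<sigma> \<and> (\<forall>u\<in>\<sigma>. u \<^bold>\<le> p)"
  shows "simplicial_boundary (\<^bold><) (cone p c) + cone p (simplicial_boundary (\<^bold><) c)
    = (c :: 'a set \<Rightarrow>\<^sub>0 'k::field)"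
proof -
  have "additive (\<lambda>c :: 'a set \<Rightarrow>\<^sub>0 'k. simplicial_boundary (\<^bold><) (cone p c) + cone p (simplicial_boundary (\<^bold><) c))"
    by (simp add: additive_def additive.add[OF additive_cone]
        additive.add[OF additive_simplicial_boundary] algebra_simps)
  then show ?thesis
    by (rule additive_eqI_single[where g = "\<lambda>x. x"])
      (use assms in \<open>auto simp: additive_def intro: boundary_cone_single\<close>)
qed

lemma (in ordering) finite_chain_has_greatest:
  assumes "finite \<sigma>" "\<sigma> \<noteq> {}" "\<forall>a\<in>\<sigma>. \<forall>b\<in>\<sigma>. a \<^bold>\<le> b \<or> b \<^bold>\<le> a"
  shows "\<exists>p\<in>\<sigma>. \<forall>u\<in>\<sigma>. u \<^bold>\<le> p"
  using assms
proof (induction rule: finite_ne_induct)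
  case (singleton x)
  then show ?case using refl by auto
next
  case (insert x F)
  then obtain p where "p \<in> F" "\<forall>u\<in>F. u \<^bold>\<le> p" by auto
  then show ?case using insert.prems refl trans by (metis insert_iff)
qed

text \<open>Faces are graded by their number of vertices, one more than the dimension, so the empty
  face sits in degree 0 and natural numbers suffice.\<close>

lemma keys_simplicial_boundary_order_complex:
  assumes "keys c \<subseteq> {\<sigma>\<in>order_complex le A. card \<sigma> = Suc i}"
  shows "keys (simplicial_boundary lt c) \<subseteq> {\<sigma>\<in>order_complex le A. card \<sigma> = i}"
proof (rule keys_additive_subset[OF additive_simplicial_boundary])
  fix \<sigma> assume "\<sigma> \<in> keys c"
  then have \<sigma>: "\<sigma> \<in> order_complex le A" "card \<sigma> = Suc i" using assms by auto
  show "keys (simplicial_boundary lt (single \<sigma> (lookup c \<sigma>))) \<subseteq> {\<sigma>\<in>order_complex le A. card \<sigma> = i}"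
    unfolding simplicial_boundary_single
    by (rule keys_sum_subset) (use \<sigma> in \<open>auto simp: order_complex_def\<close>)
qed

lemma simplicial_boundary_empty_face:
  assumes "keys c \<subseteq> {\<sigma>\<in>order_complex le A. card \<sigma> = 0}"
  shows "simplicial_boundary lt c = 0"
proof -
  have "keys c \<subseteq> {{}}" using assms by (auto simp: order_complex_def)
  then show ?thesis unfolding simplicial_boundary_def by (intro sum.neutral ballI) auto
qed

context ordering
begin

text \<open>Induction replaces the usual cancellation in a double sum. A chain is the cone over the
  face without its greatest vertex; with C the cone and d the boundary, d d C t = d (t - C d t) = d
  t - (d t - C d d t), which is 0 by the inductive hypothesis d d t = 0.\<close>

lemma boundary_boundary_single:
  assumes "finite \<sigma>" "\<forall>a\<in>\<sigma>. \<forall>b\<in>\<sigma>. a \<^bold>\<le> b \<or> b \<^bold>\<le> a"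
  shows "simplicial_boundary (\<^bold><) (simplicial_boundary (\<^bold><) (single \<sigma> (k :: 'k::field))) = 0"
  using assms
proof (induction "card \<sigma>" arbitrary: \<sigma> k)
  case 0
  then show ?case by (simp add: simplicial_boundary_single)
next
  case (Suc n)
  interpret bd: additive "simplicial_boundary (\<^bold><) :: ('a set \<Rightarrow>\<^sub>0 'k) \<Rightarrow> _"
    by (rule additive_simplicial_boundary)
  obtain p where p: "p \<in> \<sigma>" "\<forall>u\<in>\<sigma>. u \<^bold>\<le> p"
    using finite_chain_has_greatest[of \<sigma>] Suc by (metis card.empty nat.distinct(1))
  define \<tau> where "\<tau> = \<sigma> - {p}"
  \<comment> \<open>The coefficient undoes the sign that \<open>cone\<close> introduces.\<close>
  define t where "t = single \<tau> ((-1) ^ n * k)"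
  have \<tau>: "finite \<tau>" "card \<tau> = n" "\<forall>a\<in>\<tau>. \<forall>b\<in>\<tau>. a \<^bold>\<le> b \<or> b \<^bold>\<le> a"
    using Suc p by (auto simp: \<tau>_def)
  have "single \<sigma> k = cone p t"
    using p \<tau>(2) by (simp add: t_def cone_single \<tau>_def insert_absorb mult.assoc[symmetric] power_mult_distrib[symmetric])
  moreover have "simplicial_boundary (\<^bold><) (cone p t) = t - cone p (simplicial_boundary (\<^bold><) t)"
  proof -
    have "finite \<rho> \<and> (\<forall>u\<in>\<rho>. u \<^bold>\<le> p)" if "\<rho> \<in> keys t" for \<rho>
      using that \<tau>(1) p by (auto simp: t_def \<tau>_def split: if_splits)
    from boundary_cone[OF this] show ?thesis by (simp add: eq_diff_eq)
  qed
  moreover have "simplicial_boundary (\<^bold><) (cone p (simplicial_boundary (\<^bold><) t)) = simplicial_boundary (\<^bold><) t"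
  proof -
    have "keys (simplicial_boundary (\<^bold><) t) \<subseteq> Pow \<tau>"
      unfolding t_def simplicial_boundary_single by (rule keys_sum_subset) auto
    moreover have "finite \<rho> \<and> (\<forall>u\<in>\<rho>. u \<^bold>\<le> p)" if "\<rho> \<subseteq> \<tau>" for \<rho>
      using that \<tau>(1) p(2) finite_subset[of \<rho> \<tau>] by (auto simp: \<tau>_def)
    ultimately have "\<And>\<rho>. \<rho> \<in> keys (simplicial_boundary (\<^bold><) t) \<Longrightarrow> finite \<rho> \<and> (\<forall>u\<in>\<rho>. u \<^bold>\<le> p)"
      by (meson PowD subsetD)
    moreover have "simplicial_boundary (\<^bold><) (simplicial_boundary (\<^bold><) t) = 0"
      unfolding t_def using Suc(1) \<tau> by metis
    ultimately show ?thesis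
      using boundary_cone[of "simplicial_boundary (\<^bold><) t" p] by (simp add: additive.zero[OF additive_cone])
  qed
  ultimately show ?case by (simp add: bd.diff)
qed

lemma boundary_boundary:
  assumes "keys c \<subseteq> order_complex (\<^bold>\<le>) A"
  shows "simplicial_boundary (\<^bold><) (simplicial_boundary (\<^bold><) c) = (0 :: 'a set \<Rightarrow>\<^sub>0 'k::field)"
  by (rule additive_eqI_single[where g = "\<lambda>_. 0"])
    (use assms in \<open>auto simp: order_complex_def additive_def subset_iff additive.add[OF additive_simplicial_boundary]
      intro!: boundary_boundary_single\<close>)

lemma keys_cone_order_complex:
  assumes c: "keys c \<subseteq> {\<sigma>\<in>order_complex (\<^bold>\<le>) A. card \<sigma> = i}"
    and p: "p \<in> A" "\<forall>a\<in>A. a \<^bold>\<le> p"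
  shows "keys (cone p (c :: 'a set \<Rightarrow>\<^sub>0 'k::field)) \<subseteq> {\<sigma>\<in>order_complex (\<^bold>\<le>) A. card \<sigma> = Suc i}"
  unfolding cone_def
proof (rule keys_sum_subset)
  fix \<sigma> assume "\<sigma> \<in> keys c"
  then have "finite \<sigma>" "\<sigma> \<subseteq> A" "\<forall>a\<in>\<sigma>. \<forall>b\<in>\<sigma>. a \<^bold>\<le> b \<or> b \<^bold>\<le> a" "card \<sigma> = i"
    using c by (auto simp: order_complex_def)
  then show "keys (if p \<in> \<sigma> then 0 else single (insert p \<sigma>) ((-1) ^ card \<sigma> * lookup c \<sigma>))
      \<subseteq> {\<sigma>\<in>order_complex (\<^bold>\<le>) A. card \<sigma> = Suc i}"
    using p by (auto simp: order_complex_def refl)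
qed

end

section \<open>Exactness over down-sets\<close>

context ordering
begin

definition down_set :: "'a set \<Rightarrow> 'a set \<Rightarrow> bool" where
  "down_set P A \<longleftrightarrow> A \<subseteq> P \<and> (\<forall>a\<in>A. \<forall>q\<in>P. q \<^bold>\<le> a \<longrightarrow> q \<in> A)"

text \<open>
  Adding a maximal element \<open>p\<close> to a down-set is a Mayer--Vietoris step: the two pieces are the old
  down-set and the elements \<open>\<le> p\<close>, and they meet in the smaller down-set of elements \<open>< p\<close>.
\<close>

lemma exact_on_down_sets:
  fixes d :: "'v::ab_group_add \<Rightarrow> 'v" and K :: "'a set \<Rightarrow> 'v set"
  assumes fin: "finite P"
    and d: "additive d"
    and dd: "\<And>x. x \<in> K P \<Longrightarrow> d (d x) = 0"
    and K_diff: "\<And>A x y. x \<in> K A \<Longrightarrow> y \<in> K A \<Longrightarrow> x - y \<in> K A"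
    and K_mono: "\<And>A B. A \<subseteq> B \<Longrightarrow> K A \<subseteq> K B"
    and K_Int: "\<And>A B. K A \<inter> K B \<subseteq> K (A \<inter> B)"
    and K_Un: "\<And>A B z. down_set P A \<Longrightarrow> down_set P B \<Longrightarrow> z \<in> K (A \<union> B) \<Longrightarrow> \<exists>x\<in>K A. \<exists>y\<in>K B. z = x + y"
    and K_d: "\<And>A x. down_set P A \<Longrightarrow> x \<in> K A \<Longrightarrow> d x \<in> K A"
    and exact_empty: "\<And>z. z \<in> K {} \<Longrightarrow> d z = 0 \<Longrightarrow> \<exists>w\<in>K {}. d w = z"
    and exact_le: "\<And>p z. p \<in> P \<Longrightarrow> z \<in> K {q\<in>P. q \<^bold>\<le> p} \<Longrightarrow> d z = 0 \<Longrightarrow> \<exists>w\<in>K {q\<in>P. q \<^bold>\<le> p}. d w = z"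
  shows "down_set P A \<Longrightarrow> z \<in> K A \<Longrightarrow> d z = 0 \<Longrightarrow> \<exists>w\<in>K A. d w = z"
proof (induction "card A" arbitrary: A z rule: less_induct)
  case less
  interpret d: additive d by fact
  have AP: "A \<subseteq> P" and A_down: "\<And>a q. a \<in> A \<Longrightarrow> q \<in> P \<Longrightarrow> q \<^bold>\<le> a \<Longrightarrow> q \<in> A"
    using less.prems(1) by (auto simp: down_set_def)
  have finA: "finite A" using AP fin finite_subset by blast
  \<comment> \<open>Only closure under differences is assumed; \<open>y - y\<close> provides zero
    and from it negatives.\<close>
  have K_add: "x + y \<in> K B" if "x \<in> K B" "y \<in> K B" for B x y
    using K_diff[OF that(1) K_diff[OF K_diff[OF that(2) that(2)] that(2)]] by simp
  show ?case
  proof (cases "A = {}")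
    case True
    then show ?thesis using exact_empty less.prems by blast
  next
    case False
    obtain p where p: "p \<in> A" "\<And>a. a \<in> A \<Longrightarrow> p \<^bold>\<le> a \<Longrightarrow> a = p"
      using Finite_Set.bex_max_element[OF finA _ _ False, of "(\<^bold><)"]
      by (metis asym asymp_onI strict_iff_order strict_trans transp_onI)
    define L where "L = {q\<in>P. q \<^bold>\<le> p}"
    define A' where "A' = A - {p}"
    have LA: "L \<subseteq> A" using A_down p(1) by (auto simp: L_def)
    have pP: "p \<in> P" using p(1) AP by blast
    have down: "down_set P L" "down_set P A'" "down_set P (L \<inter> A')"
      using AP A_down p trans antisym by (auto simp: L_def A'_def down_set_def)
    have less_card: "card A' < card A" "card (L \<inter> A') < card A"
      using p(1) finA by (auto simp: A'_def simp del: card_Diff_insert card_Diff_singleton intro!: psubset_card_mono)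
    have "A = L \<union> A'" using LA p(1) pP refl by (auto simp: A'_def L_def)
    then obtain x y where x: "x \<in> K L" and y: "y \<in> K A'" and z: "z = x + y"
      using K_Un[OF down(1,2)] less.prems(2) by metis
    \<comment> \<open>Since \<open>z\<close> is a cycle, \<open>d x\<close> lies in both pieces,
      hence in the intersection, which is a smaller down-set.\<close>
    have dxy: "d x = - d y" using less.prems(3) by (simp add: z d.add eq_neg_iff_add_eq_0)
    have "d x \<in> K A'"
      using K_d[OF down(2) y] K_diff[OF K_diff[OF y y] K_d[OF down(2) y]] dxy by simp
    then have "d x \<in> K (L \<inter> A')" using K_d[OF down(1) x] K_Int by blast
    moreover have "d (d x) = 0" using dd K_mono[OF subset_trans[OF LA AP]] x by blast
    ultimately obtain w where w: "w \<in> K (L \<inter> A')" "d w = d x"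
      using less.hyps[OF less_card(2) down(3)] by blast
    \<comment> \<open>Moving \<open>w\<close> from one summand to the other turns both into cycles
      of their own pieces without changing the sum.\<close>
    have "x - w \<in> K L" using x w(1) K_mono[of "L \<inter> A'" L] K_diff by blast
    then obtain u where u: "u \<in> K L" "d u = x - w"
      using exact_le[OF pP, of "x - w"] w(2) by (auto simp: L_def d.diff)
    have "y + w \<in> K A'" using y w(1) K_mono[of "L \<inter> A'" A'] K_add by blast
    then obtain v where v: "v \<in> K A'" "d v = y + w"
      using less.hyps[OF less_card(1) down(2), of "y + w"] w(2) dxy by (auto simp: d.add)
    have "u + v \<in> K A"
      using u(1) v(1) K_mono[OF LA] K_mono[of A' A] K_add[of u A v] by (auto simp: A'_def)
    moreover have "d (u + v) = z" by (simp add: d.add u v z)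
    ultimately show ?thesis by blast
  qed
qed

end

section \<open>Comparison with the order complex\<close>

definition scalar_diff ::
    "(nat \<Rightarrow> 'b set) \<Rightarrow> (nat \<Rightarrow> 'b \<Rightarrow> 'b \<Rightarrow> 'k::field) \<Rightarrow> nat \<Rightarrow> ('b \<Rightarrow>\<^sub>0 'k) \<Rightarrow> ('b \<Rightarrow>\<^sub>0 'k)" where
  "scalar_diff B c i v = (\<Sum>e\<in>B i. \<Sum>e'\<in>B (i - 1). single e' (lookup v e * c i e e'))"

text \<open>In degree 0 every element counts as a cycle: R/M is zero in a multidegree belonging to
  M, so degree 0 must be hit completely. The disjunct also avoids \<open>scalar_diff B c 0\<close>,
  which truncated subtraction makes a spurious map from degree 0 to itself.\<close>

definition exact_on ::
    "(nat \<Rightarrow> 'b set) \<Rightarrow> (nat \<Rightarrow> 'b \<Rightarrow> 'b \<Rightarrow> 'k::field) \<Rightarrow> (nat \<Rightarrow> 'b set) \<Rightarrow> bool" where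
  "exact_on B c S \<longleftrightarrow> (\<forall>i z. keys z \<subseteq> S i \<longrightarrow> i = 0 \<or> scalar_diff B c i z = 0 \<longrightarrow>
     (\<exists>w. keys w \<subseteq> S (Suc i) \<and> scalar_diff B c (Suc i) w = z))"

lemma additive_scalar_diff: "additive (scalar_diff B c i)"
  by (simp add: additive_def scalar_diff_def lookup_add distrib_right single_add sum.distrib)

lemma lookup_scalar_diff:
  assumes "finite (B i)"
  shows "lookup (scalar_diff B c (Suc i) v) e'
    = (if e' \<in> B i then \<Sum>e\<in>B (Suc i). lookup v e * c (Suc i) e e' else 0)"
  using assms by (simp add: scalar_diff_def lookup_sum lookup_single when_def)

text \<open>\<open>B 0\<close> is a singleton because the resolved module R/M is cyclic.\<close>

locale based_complex =
  fixes B :: "nat \<Rightarrow> 'b set" and c :: "nat \<Rightarrow> 'b \<Rightarrow> 'b \<Rightarrow> 'k::field" and e0 :: 'b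
  assumes finite_B: "finite (B i)"
    and B0: "B 0 = {e0}"
    and scalar_diff_scalar_diff: "scalar_diff B c (Suc i) (scalar_diff B c (Suc (Suc i)) v) = 0"
begin

abbreviation sd :: "nat \<Rightarrow> ('b \<Rightarrow>\<^sub>0 'k) \<Rightarrow> ('b \<Rightarrow>\<^sub>0 'k)" where
  "sd \<equiv> scalar_diff B c"

lemma keys_scalar_diff_subset:
  assumes "\<And>e e'. e \<in> keys v \<Longrightarrow> e \<in> B (Suc i) \<Longrightarrow> e' \<in> B i \<Longrightarrow> c (Suc i) e e' \<noteq> 0 \<Longrightarrow> e' \<in> T"
  shows "keys (sd (Suc i) v) \<subseteq> T"
proof
  fix e' assume "e' \<in> keys (sd (Suc i) v)"
  then have "e' \<in> B i \<and> (\<Sum>e\<in>B (Suc i). lookup v e * c (Suc i) e e') \<noteq> 0"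
    by (auto simp: in_keys_iff lookup_scalar_diff[OF finite_B] split: if_splits)
  then obtain e where "e \<in> B (Suc i)" "lookup v e * c (Suc i) e e' \<noteq> 0" "e' \<in> B i"
    by (meson sum.not_neutral_contains_not_neutral)
  then show "e' \<in> T" using assms[of e e'] by (auto simp: in_keys_iff)
qed

text \<open>A chain map built in the manner of acyclic carriers: the image of the boundary of
  \<open>e\<close> is a cycle on labels below the label of \<open>e\<close>, and the cone with that
  label as apex is a preimage of it under the simplicial boundary. Keeping the coefficient inside
  \<open>single e (lookup v e)\<close> avoids scalar multiplication.\<close>

primrec to_chains :: "(nat \<Rightarrow> 'b \<Rightarrow> 'a) \<Rightarrow> nat \<Rightarrow> ('b \<Rightarrow>\<^sub>0 'k) \<Rightarrow> ('a set \<Rightarrow>\<^sub>0 'k)" where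
  "to_chains lab 0 v = single {} (lookup v e0)"
| "to_chains lab (Suc i) v =
    (\<Sum>e\<in>B (Suc i). cone (lab (Suc i) e) (to_chains lab i (sd (Suc i) (single e (lookup v e)))))"

lemma additive_to_chains: "additive (to_chains lab i)"
proof (induction i)
  case 0
  then show ?case by (simp add: additive_def lookup_add single_add)
next
  case (Suc i)
  then show ?case
    by (simp add: additive_def lookup_add single_add additive.add[OF additive_scalar_diff]
        additive.add[OF additive_cone] sum.distrib)
qed

text \<open>Degree 0 corresponds to the empty face, so it belongs to the subcomplex of every label set.\<close>

definition labels_in :: "(nat \<Rightarrow> 'b \<Rightarrow> 'a) \<Rightarrow> 'a set \<Rightarrow> nat \<Rightarrow> 'b set" where
  "labels_in lab A i = {e\<in>B i. i = 0 \<or> lab i e \<in> A}"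

end

text \<open>\<open>lab_P\<close> starts with the map from degree 2 to degree 1: in the application
  the label of \<open>e0\<close> is 1, which is outside the open interval \<open>P\<close>.\<close>

locale labelled_complex = based_complex B c e0 + ordering less_eq less
  for B :: "nat \<Rightarrow> 'b set" and c :: "nat \<Rightarrow> 'b \<Rightarrow> 'b \<Rightarrow> 'k::field" and e0
    and less_eq :: "'a \<Rightarrow> 'a \<Rightarrow> bool" (infix "\<^bold>\<le>" 50) and less (infix "\<^bold><" 50) +
  fixes lab :: "nat \<Rightarrow> 'b \<Rightarrow> 'a" and P :: "'a set"
  assumes finite_P: "finite P"
    and lab_P: "e \<in> B (Suc (Suc i)) \<Longrightarrow> lab (Suc (Suc i)) e \<in> P \<Longrightarrow> e' \<in> B (Suc i) \<Longrightarrow>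
      c (Suc (Suc i)) e e' \<noteq> 0 \<Longrightarrow> lab (Suc i) e' \<in> P \<and> lab (Suc i) e' \<^bold>\<le> lab (Suc (Suc i)) e"
begin

abbreviation bd :: "('a set \<Rightarrow>\<^sub>0 'k) \<Rightarrow> ('a set \<Rightarrow>\<^sub>0 'k)" where
  "bd \<equiv> simplicial_boundary (\<^bold><)"

abbreviation faces :: "'a set \<Rightarrow> nat \<Rightarrow> 'a set set" where
  "faces A i \<equiv> {\<sigma> \<in> order_complex (\<^bold>\<le>) A. card \<sigma> = i}"

lemma keys_scalar_diff_labels_in:
  assumes "down_set P A" "keys v \<subseteq> labels_in lab A (Suc i)"
  shows "keys (sd (Suc i) v) \<subseteq> labels_in lab A i"
proof (rule keys_scalar_diff_subset)
  fix e e' assume e: "e \<in> keys v" "e \<in> B (Suc i)" "e' \<in> B i" "c (Suc i) e e' \<noteq> 0"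
  then have "lab (Suc i) e \<in> A" using assms(2) by (auto simp: labels_in_def)
  show "e' \<in> labels_in lab A i"
  proof (cases i)
    case 0
    then show ?thesis using e by (simp add: labels_in_def)
  next
    case (Suc j)
    have "lab (Suc i) e \<in> P" using \<open>lab (Suc i) e \<in> A\<close> assms(1) by (auto simp: down_set_def)
    then have "lab i e' \<in> P" "lab i e' \<^bold>\<le> lab (Suc i) e"
      using lab_P[of e j e'] e by (auto simp: Suc)
    then show ?thesis
      using e(3) assms(1) \<open>lab (Suc i) e \<in> A\<close> unfolding labels_in_def down_set_def by blast
  qed
qed

lemma faces_mono: "A \<subseteq> A' \<Longrightarrow> faces A i \<subseteq> faces A' i"
  by (auto simp: order_complex_def)

lemma down_set_le: "down_set P {q\<in>P. q \<^bold>\<le> p}"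
  using trans by (auto simp: down_set_def)

text \<open>The set \<open>A\<close> varies in the induction because each step works among the
  elements below the label \<open>p\<close> of one basis element: there \<open>p\<close> is
  greatest, so coning with apex \<open>p\<close> stays in the order complex.\<close>

lemma keys_to_chains:
  assumes "down_set P A" "keys v \<subseteq> labels_in lab A i"
  shows "keys (to_chains lab i v) \<subseteq> faces A i"
  using assms
proof (induction i arbitrary: A v)
  case 0
  then show ?case by (simp add: order_complex_def)
next
  case (Suc i)
  show ?case unfolding to_chains.simps
  proof (rule keys_sum_subset)
    fix e assume e: "e \<in> B (Suc i)"
    show "keys (cone (lab (Suc i) e) (to_chains lab i (sd (Suc i) (single e (lookup v e))))) \<subseteq> faces A (Suc i)"
    proof (cases "lookup v e = 0")
      case True
      then show ?thesis
        by (simp add: additive.zero[OF additive_scalar_diff] additive.zero[OF additive_to_chains]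
            additive.zero[OF additive_cone])
    next
      case False
      define p where "p = lab (Suc i) e"
      have "e \<in> keys v" using False by (simp add: in_keys_iff)
      then have p: "p \<in> A" using Suc.prems(2) by (auto simp: labels_in_def p_def)
      have pP: "p \<in> P" using p Suc.prems(1) by (auto simp: down_set_def)
      have sub: "{q\<in>P. q \<^bold>\<le> p} \<subseteq> A" using p Suc.prems(1) by (auto simp: down_set_def)
      have "keys (single e (lookup v e)) \<subseteq> labels_in lab {q\<in>P. q \<^bold>\<le> p} (Suc i)"
        using e pP refl by (auto simp: labels_in_def p_def)
      from keys_scalar_diff_labels_in[OF down_set_le this]
      have "keys (to_chains lab i (sd (Suc i) (single e (lookup v e)))) \<subseteq> faces {q\<in>P. q \<^bold>\<le> p} i"
        by (rule Suc.IH[OF down_set_le])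
      then have "keys (cone p (to_chains lab i (sd (Suc i) (single e (lookup v e))))) \<subseteq> faces {q\<in>P. q \<^bold>\<le> p} (Suc i)"
        by (rule keys_cone_order_complex) (use pP refl in auto)
      also have "\<dots> \<subseteq> faces A (Suc i)" by (rule faces_mono[OF sub])
      finally show ?thesis by (simp add: p_def)
    qed
  qed
qed

lemma down_set_P: "down_set P P"
  by (simp add: down_set_def)

text \<open>By the homotopy formula the boundary of a cone over a cycle is that cycle. The base is a
  cycle by the preceding degree and because the differential squares to zero; in the lowest degree
  it is a multiple of the empty face.\<close>

lemma boundary_to_chains:
  assumes "keys v \<subseteq> labels_in lab P (Suc i)"
  shows "bd (to_chains lab (Suc i) v) = to_chains lab i (sd (Suc i) v)"
  using assms
proof (induction i arbitrary: v)
  have step: "bd (to_chains lab (Suc i) v) = to_chains lab i (sd (Suc i) v)"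
    if v: "keys v \<subseteq> labels_in lab P (Suc i)"
      and cycle: "\<And>e. e \<in> keys v \<Longrightarrow> bd (to_chains lab i (sd (Suc i) (single e (lookup v e)))) = 0"
    for i and v
  proof -
    interpret tc: additive "to_chains lab i :: _ \<Rightarrow> 'a set \<Rightarrow>\<^sub>0 'k" by (rule additive_to_chains)
    interpret d: additive "sd (Suc i)" by (rule additive_scalar_diff)
    interpret b: additive "bd" by (rule additive_simplicial_boundary)
    define x where "x e = to_chains lab i (sd (Suc i) (single e (lookup v e)))" for e
    have "bd (cone (lab (Suc i) e) (x e)) = x e" if "e \<in> B (Suc i)" for e
    proof (cases "e \<in> keys v")
      case False
      then show ?thesis
        by (simp add: x_def in_keys_iff d.zero tc.zero additive.zero[OF additive_cone])
    next
      case True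
      define p where "p = lab (Suc i) e"
      have "p \<in> P" using v True by (auto simp: labels_in_def p_def)
      then have "keys (single e (lookup v e)) \<subseteq> labels_in lab {q\<in>P. q \<^bold>\<le> p} (Suc i)"
        using that refl by (auto simp: labels_in_def p_def)
      from keys_to_chains[OF down_set_le keys_scalar_diff_labels_in[OF down_set_le this]]
      have "keys (x e) \<subseteq> faces {q\<in>P. q \<^bold>\<le> p} i" by (simp add: x_def)
      then have "bd (cone p (x e)) + cone p (bd (x e)) = x e"
        by (intro boundary_cone) (auto simp: order_complex_def)
      then show ?thesis using cycle[OF True] by (simp add: x_def p_def additive.zero[OF additive_cone])
    qed
    then have "bd (to_chains lab (Suc i) v) = (\<Sum>e\<in>B (Suc i). x e)"
      by (simp add: b.sum x_def[symmetric])
    also have "\<dots> = to_chains lab i (sd (Suc i) (\<Sum>e\<in>B (Suc i). single e (lookup v e)))"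
      by (simp add: x_def tc.sum d.sum)
    also have "(\<Sum>e\<in>B (Suc i). single e (lookup v e)) = (\<Sum>e\<in>keys v. single e (lookup v e))"
      using v finite_B by (intro sum.mono_neutral_right) (auto simp: labels_in_def in_keys_iff)
    finally show ?thesis by (simp add: poly_mapping_sum_single)
  qed
  {
    case 0
    then show ?case by (intro step) (simp_all add: simplicial_boundary_single)
  next
    case (Suc i)
    have "bd (to_chains lab (Suc i) (sd (Suc (Suc i)) (single e (lookup v e)))) = 0" if "e \<in> keys v" for e
    proof -
      have "keys (single e (lookup v e)) \<subseteq> labels_in lab P (Suc (Suc i))" using Suc.prems that by auto
      then show ?thesis
        by (subst Suc.IH[OF keys_scalar_diff_labels_in[OF down_set_P]])
          (simp_all add: scalar_diff_scalar_diff additive.zero[OF additive_to_chains])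
    qed
    then show ?case by (rule step[OF Suc.prems])
  }
qed

text \<open>A cycle \<open>z\<close> is sent to a cycle, which bounds some \<open>u\<close> by
  acyclicity. Then \<open>(z, u)\<close> is a cycle of the mapping cone, and the first component of
  a preimage bounds \<open>z\<close>.\<close>

theorem exact_on_labels_in:
  assumes exact_le: "\<And>p. p \<in> P \<Longrightarrow> exact_on B c (labels_in lab {q\<in>P. q \<^bold>\<le> p})"
    and acyclic: "\<And>i y. keys y \<subseteq> faces P i \<Longrightarrow> bd y = 0 \<Longrightarrow> \<exists>u. keys u \<subseteq> faces P (Suc i) \<and> bd u = y"
  shows "exact_on B c (labels_in lab P)"
proof -
  \<comment> \<open>All degrees are collected in one function, since
    \<open>exact_on_down_sets\<close> speaks of a single endomorphism.\<close>
  define D where "D A = {z :: nat \<Rightarrow> 'b \<Rightarrow>\<^sub>0 'k. \<forall>i. keys (z i) \<subseteq> labels_in lab A i}" for A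
  define E where "E A = {y :: nat \<Rightarrow> 'a set \<Rightarrow>\<^sub>0 'k. \<forall>i. keys (y i) \<subseteq> faces A i}" for A
  define K where "K A = D A \<times> E A" for A
  \<comment> \<open>The differential of the mapping cone of \<open>to_chains\<close>: elements of
    homological degree \<open>i\<close> are paired with chains of faces with \<open>i + 1\<close>
    vertices.\<close>
  define dK :: "(nat \<Rightarrow> 'b \<Rightarrow>\<^sub>0 'k) \<times> (nat \<Rightarrow> 'a set \<Rightarrow>\<^sub>0 'k) \<Rightarrow> _"
    where "dK zy = (\<lambda>i. sd (Suc i) (fst zy (Suc i)), \<lambda>i. to_chains lab i (fst zy i) - bd (snd zy (Suc i)))" for zy
  note tc = additive_to_chains[of lab] and sda = additive_scalar_diff[of B c]
    and bda = additive_simplicial_boundary[of "(\<^bold><)"]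
  have additive_dK: "additive dK"
    by (auto simp: additive_def dK_def fun_eq_iff additive.add[OF tc] additive.add[OF sda]
        additive.add[OF bda])
  have dd: "dK (dK x) = 0" if "x \<in> K P" for x
  proof -
    obtain z y where x: "x = (z, y)" by force
    have zy: "keys (z i) \<subseteq> labels_in lab P i" "keys (y i) \<subseteq> order_complex (\<^bold>\<le>) P" for i
      using that by (auto simp: x K_def D_def E_def)
    show ?thesis
      by (simp add: x dK_def zero_prod_def fun_eq_iff scalar_diff_scalar_diff additive.diff[OF bda]
          boundary_to_chains[OF zy(1)] boundary_boundary[OF zy(2)] del: to_chains.simps)
  qed
  have K_diff: "x - y \<in> K A" if xy: "x \<in> K A" "y \<in> K A" for A x y
  proof -
    have "keys (fst x i) \<subseteq> labels_in lab A i" "keys (fst y i) \<subseteq> labels_in lab A i"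
      "keys (snd x i) \<subseteq> faces A i" "keys (snd y i) \<subseteq> faces A i" for i
      using xy by (simp_all add: K_def D_def E_def mem_Times_iff)
    then have "keys (fst x i - fst y i) \<subseteq> labels_in lab A i" "keys (snd x i - snd y i) \<subseteq> faces A i" for i
      by (meson subset_trans[OF keys_diff Un_least])+
    then show ?thesis by (simp add: K_def D_def E_def mem_Times_iff)
  qed
  have K_mono: "K A \<subseteq> K A'" if "A \<subseteq> A'" for A A'
  proof -
    have "labels_in lab A i \<subseteq> labels_in lab A' i" for i
      using that by (auto simp: labels_in_def)
    then show ?thesis using faces_mono[OF that] unfolding K_def D_def E_def by blast
  qed
  have K_Int: "K A \<inter> K A' \<subseteq> K (A \<inter> A')" for A A'
  proof -
    have "labels_in lab A i \<inter> labels_in lab A' i = labels_in lab (A \<inter> A') i"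
      "faces A i \<inter> faces A' i = faces (A \<inter> A') i" for i
      by (auto simp: labels_in_def order_complex_def)
    then show ?thesis unfolding K_def D_def E_def by blast
  qed
  \<comment> \<open>A chain in \<open>P\<close> lies in any down-set that contains its greatest
    element. For arbitrary sets a chain could be spread over both.\<close>
  have faces_Un: "faces (A \<union> A') i \<subseteq> faces A i \<union> faces A' i" if A: "down_set P A" "down_set P A'" for A A' i
  proof
    fix \<sigma> assume \<sigma>: "\<sigma> \<in> faces (A \<union> A') i"
    show "\<sigma> \<in> faces A i \<union> faces A' i"
    proof (cases "\<sigma> = {}")
      case True
      then show ?thesis using \<sigma> by (auto simp: order_complex_def)
    next
      case False
      then obtain p where p: "p \<in> \<sigma>" "\<forall>u\<in>\<sigma>. u \<^bold>\<le> p"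
        using finite_chain_has_greatest[of \<sigma>] \<sigma> by (auto simp: order_complex_def)
      have sub: "\<sigma> \<subseteq> A \<union> A'" using \<sigma> by (simp add: order_complex_def)
      then have "\<sigma> \<subseteq> P" using A by (auto simp: down_set_def)
      then have "\<sigma> \<subseteq> C" if "down_set P C" "p \<in> C" for C
        using that p(2) unfolding down_set_def by blast
      then have "\<sigma> \<subseteq> A \<or> \<sigma> \<subseteq> A'" using sub p(1) A by blast
      then show ?thesis using \<sigma> by (auto simp: order_complex_def)
    qed
  qed
  have K_Un: "\<exists>x\<in>K A. \<exists>y\<in>K A'. zy = x + y"
    if A: "down_set P A" "down_set P A'" and zy: "zy \<in> K (A \<union> A')" for A A' zy
  proof -
    have "labels_in lab (A \<union> A') i \<subseteq> labels_in lab A i \<union> labels_in lab A' i" for i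
      by (auto simp: labels_in_def)
    then have "keys (fst zy i) \<subseteq> labels_in lab A i \<union> labels_in lab A' i"
      "keys (snd zy i) \<subseteq> faces A i \<union> faces A' i" for i
      using zy faces_Un[OF A, of i] unfolding K_def D_def E_def mem_Times_iff mem_Collect_eq
      by (meson subset_trans)+
    from poly_mapping_split[OF this(1)] poly_mapping_split[OF this(2)]
    have ex: "\<forall>i. \<exists>x y. fst zy i = x + y \<and> keys x \<subseteq> labels_in lab A i \<and> keys y \<subseteq> labels_in lab A' i"
      "\<forall>i. \<exists>x y. snd zy i = x + y \<and> keys x \<subseteq> faces A i \<and> keys y \<subseteq> faces A' i"
      by blast+
    from ex(1) obtain z1 z2 where
      z: "\<And>i. fst zy i = z1 i + z2 i \<and> keys (z1 i) \<subseteq> labels_in lab A i \<and> keys (z2 i) \<subseteq> labels_in lab A' i"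
      unfolding choice_iff by blast
    from ex(2) obtain y1 y2 where
      y: "\<And>i. snd zy i = y1 i + y2 i \<and> keys (y1 i) \<subseteq> faces A i \<and> keys (y2 i) \<subseteq> faces A' i"
      unfolding choice_iff by blast
    have "(z1, y1) \<in> K A" "(z2, y2) \<in> K A'" "zy = (z1, y1) + (z2, y2)"
      using z y unfolding K_def D_def E_def by (simp_all add: prod_eq_iff fun_eq_iff)
    then show ?thesis by blast
  qed
  have K_dK: "dK x \<in> K A" if A: "down_set P A" and x: "x \<in> K A" for A x
  proof -
    have x1: "keys (fst x i) \<subseteq> labels_in lab A i" and x2: "keys (snd x i) \<subseteq> faces A i" for i
      using x by (simp_all add: K_def D_def E_def mem_Times_iff)
    have "keys (to_chains lab i (fst x i) - bd (snd x (Suc i))) \<subseteq> faces A i" for i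
      using subset_trans[OF keys_diff Un_least]
        keys_to_chains[OF A x1] keys_simplicial_boundary_order_complex[OF x2] by meson
    then show ?thesis
      using keys_scalar_diff_labels_in[OF A x1] by (simp add: K_def D_def E_def dK_def)
  qed
  \<comment> \<open>Over the empty label set both complexes are one-dimensional and sit in degree 0,
    and \<open>to_chains\<close> identifies \<open>e0\<close> with the empty face.\<close>
  have exact_empty: "\<exists>w\<in>K {}. dK w = zy" if zy: "zy \<in> K {}" "dK zy = 0" for zy
  proof -
    define k where "k = lookup (snd zy 0) {}"
    define w :: "nat \<Rightarrow> 'b \<Rightarrow>\<^sub>0 'k" where "w i = (if i = 0 then single e0 k else 0)" for i
    have keys1: "keys (fst zy i) \<subseteq> labels_in lab {} i" and keys2: "keys (snd zy i) \<subseteq> faces {} i" for i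
      using zy(1) by (simp_all add: K_def D_def E_def mem_Times_iff)
    have face0: "faces {} 0 = {{}}" and faceS: "faces {} (Suc i) = {}" for i
      by (auto simp: order_complex_def)
    have y0: "snd zy 0 = single {} k"
      by (rule poly_mapping_eqI) (use keys2[of 0] in \<open>auto simp: face0 k_def lookup_single when_def in_keys_iff\<close>)
    have yS: "snd zy (Suc i) = 0" for i using keys2[of "Suc i"] by (simp add: faceS)
    have zS: "fst zy (Suc i) = 0" for i using keys1[of "Suc i"] by (simp add: labels_in_def)
    have "snd (dK zy) 0 = 0" using zy(2) by (simp add: zero_prod_def)
    then have "single {} (lookup (fst zy 0) e0) = (0 :: 'a set \<Rightarrow>\<^sub>0 'k)" by (simp add: dK_def yS)
    then have "lookup (fst zy 0) e0 = 0" by (metis lookup_single_eq lookup_zero)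
    then have z0: "fst zy 0 = 0" using keys1[of 0] by (auto simp: labels_in_def B0 in_keys_iff intro!: poly_mapping_eqI)
    have "dK (w, 0) = zy"
    proof -
      have "fst zy i = 0" for i by (cases i) (simp_all add: z0 zS)
      moreover have "snd zy i = to_chains lab i (w i)" for i
        by (cases i) (simp_all add: y0 yS w_def additive.zero[OF tc, of "Suc _"] del: to_chains.simps(2))
      ultimately show ?thesis
        by (auto simp: dK_def prod_eq_iff fun_eq_iff w_def additive.zero[OF sda])
    qed
    moreover have "(w, 0) \<in> K {}"
      by (auto simp: K_def D_def E_def w_def labels_in_def B0 split: if_splits)
    ultimately show ?thesis by blast
  qed
  \<comment> \<open>Below \<open>p\<close> both parts are exact: the labelled complex by assumption,
    the order complex by coning. After a preimage \<open>w\<close> of the first component is chosen,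
    the cone \<open>v\<close> with apex \<open>p\<close> corrects the error \<open>u\<close> left in
    the second.\<close>
  have exact_le_K: "\<exists>w\<in>K {q\<in>P. q \<^bold>\<le> p}. dK w = zy"
    if p: "p \<in> P" and zy: "zy \<in> K {q\<in>P. q \<^bold>\<le> p}" "dK zy = 0" for p zy
  proof -
    let ?L = "{q\<in>P. q \<^bold>\<le> p}"
    have keys1: "keys (fst zy i) \<subseteq> labels_in lab ?L i" and keys2: "keys (snd zy i) \<subseteq> faces ?L i" for i
      using zy(1) by (simp_all add: K_def D_def E_def mem_Times_iff)
    have cyc1: "sd (Suc i) (fst zy (Suc i)) = 0"
      and cyc2: "to_chains lab i (fst zy i) = bd (snd zy (Suc i))" for i
      using zy(2) by (simp_all add: dK_def zero_prod_def fun_eq_iff)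
    have "\<exists>w. keys w \<subseteq> labels_in lab ?L (Suc i) \<and> sd (Suc i) w = fst zy i" for i
    proof -
      have "i = 0 \<or> sd i (fst zy i) = 0" using cyc1 by (cases i) auto
      then show ?thesis using exact_le[OF p] keys1[of i] unfolding exact_on_def by blast
    qed
    then obtain w' where w': "\<And>i. keys (w' i) \<subseteq> labels_in lab ?L (Suc i)" "\<And>i. sd (Suc i) (w' i) = fst zy i"
      by metis
    \<comment> \<open>The preimage of the part in degree \<open>j\<close> lives in degree
      \<open>Suc j\<close>; degree 0 has nothing to bound.\<close>
    define w where "w i = (case i of 0 \<Rightarrow> 0 | Suc j \<Rightarrow> w' j)" for i
    have w: "keys (w i) \<subseteq> labels_in lab ?L i" for i
      using w'(1) by (cases i) (auto simp: w_def)
    define u where "u i = to_chains lab i (w i) - snd zy i" for i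
    have u: "keys (u i) \<subseteq> faces ?L i" for i
      unfolding u_def using subset_trans[OF keys_diff Un_least]
        keys_to_chains[OF down_set_le w] keys2 by meson
    have bu: "bd (u i) = 0" for i
    proof (cases i)
      case 0
      then show ?thesis using simplicial_boundary_empty_face u by metis
    next
      case (Suc j)
      have "keys (w (Suc j)) \<subseteq> labels_in lab P (Suc j)"
        using w[of "Suc j"] by (auto simp: labels_in_def)
      from boundary_to_chains[OF this] show ?thesis
        unfolding u_def Suc additive.diff[OF bda] cyc2[symmetric] by (simp add: w_def w'(2))
    qed
    define v where "v i = (case i of 0 \<Rightarrow> 0 | Suc j \<Rightarrow> cone p (u j))" for i
    have v: "keys (v i) \<subseteq> faces ?L i" for i
    proof (cases i)
      case (Suc j)
      have "keys (cone p (u j)) \<subseteq> faces ?L (Suc j)"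
        using u by (rule keys_cone_order_complex) (use p refl in auto)
      then show ?thesis by (simp add: v_def Suc)
    qed (simp add: v_def)
    have bv: "bd (v (Suc i)) = u i" for i
    proof -
      have "bd (cone p (u i)) + cone p (bd (u i)) = u i"
        by (rule boundary_cone) (use u[of i] in \<open>auto simp: order_complex_def\<close>)
      then show ?thesis by (simp add: v_def bu additive.zero[OF additive_cone])
    qed
    have "dK (w, v) = zy"
      by (auto simp: dK_def prod_eq_iff fun_eq_iff bv u_def w'(2)) (simp add: w_def w'(2))
    moreover have "(w, v) \<in> K ?L" using w v by (simp add: K_def D_def E_def)
    ultimately show ?thesis by blast
  qed
  note exact_K = exact_on_down_sets[OF finite_P additive_dK dd K_diff K_mono K_Int K_Un K_dK exact_empty exact_le_K
      down_set_P]
  show ?thesis unfolding exact_on_def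
  proof (intro allI impI)
    fix i and z :: "'b \<Rightarrow>\<^sub>0 'k"
    assume z: "keys z \<subseteq> labels_in lab P i" and cyc: "i = 0 \<or> sd i z = 0"
    have tz: "keys (to_chains lab i z) \<subseteq> faces P i" by (rule keys_to_chains[OF down_set_P z])
    have "bd (to_chains lab i z) = 0"
    proof (cases i)
      case 0
      then show ?thesis using simplicial_boundary_empty_face tz by metis
    next
      case (Suc j)
      then show ?thesis using boundary_to_chains[of z j] z cyc by (simp add: additive.zero[OF tc] del: to_chains.simps)
    qed
    then obtain u where u: "keys u \<subseteq> faces P (Suc i)" "bd u = to_chains lab i z"
      using acyclic[OF tz] by blast
    define Z where "Z j = (if j = i then z else 0)" for j
    define Y where "Y j = (if j = Suc i then u else 0)" for j
    have "(Z, Y) \<in> K P" using z u(1) by (auto simp: K_def D_def E_def Z_def Y_def split: if_splits)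
    moreover have "dK (Z, Y) = 0"
      using cyc by (auto simp: dK_def zero_prod_def fun_eq_iff Z_def Y_def u(2) additive.zero[OF tc]
          additive.zero[OF sda])
    ultimately obtain w where w: "w \<in> K P" "dK w = (Z, Y)" using exact_K by blast
    have "keys (fst w (Suc i)) \<subseteq> labels_in lab P (Suc i)"
      using w(1) by (simp add: K_def D_def mem_Times_iff)
    moreover have "sd (Suc i) (fst w (Suc i)) = Z i"
      using arg_cong[OF w(2), of "\<lambda>q. fst q i"] by (simp add: dK_def)
    ultimately show "\<exists>w. keys w \<subseteq> labels_in lab P (Suc i) \<and> sd (Suc i) w = z"
      by (auto simp: Z_def)
  qed
qed

end

section \<open>Strands of a free resolution\<close>

lemma lookup_differential:
  assumes "finite (basis G i)"
  shows "lookup (differential G (Suc i) V) e'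
    = (if e' \<in> basis G i then \<Sum>e\<in>basis G (Suc i). lookup V e * entry G (Suc i) e e' else 0)"
  using assms by (simp add: differential_def lookup_sum lookup_single when_def)

lemma keys_differential: "finite (basis G i) \<Longrightarrow> keys (differential G (Suc i) V) \<subseteq> basis G i"
  by (auto simp: in_keys_iff lookup_differential split: if_splits)

lemma differential_single:
  assumes "finite (basis G i)" "finite (basis G (Suc i))" "e \<in> basis G (Suc i)"
  shows "lookup (differential G (Suc i) (single e p)) e' = (if e' \<in> basis G i then p * entry G (Suc i) e e' else 0)"
proof -
  have "(\<Sum>a\<in>basis G (Suc i). lookup (single e p) a * entry G (Suc i) a e') = p * entry G (Suc i) e e'"
    using assms(2,3)
    by (subst sum.remove[of _ e]) (auto simp: lookup_single when_def intro!: sum.neutral split: if_splits)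
  then show ?thesis by (simp add: lookup_differential[OF assms(1)])
qed

text \<open>\<open>c_dvd\<close> makes the truncated difference in \<open>entry_eq\<close> the
  exponent of a true quotient of monomials wherever the scalar is nonzero.\<close>

locale monomial_matrices =
  fixes G :: "('b, 'x::finite, 'k::field) based_seq" and lab :: "nat \<Rightarrow> 'b \<Rightarrow> 'x mono"
    and c :: "nat \<Rightarrow> 'b \<Rightarrow> 'b \<Rightarrow> 'k"
  assumes finite_basis: "finite (basis G i)"
    and entry_eq: "e \<in> basis G (Suc i) \<Longrightarrow> e' \<in> basis G i \<Longrightarrow>
      entry G (Suc i) e e' = single (lab (Suc i) e - lab i e') (c (Suc i) e e')"
    and c_dvd: "e \<in> basis G (Suc i) \<Longrightarrow> e' \<in> basis G i \<Longrightarrow> c (Suc i) e e' \<noteq> 0 \<Longrightarrow>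
      mono_dvd (lab i e') (lab (Suc i) e)"
begin

abbreviation below :: "'x mono \<Rightarrow> nat \<Rightarrow> 'b set" where
  "below a i \<equiv> {e \<in> basis G i. mono_dvd (lab i e) a}"

text \<open>The component of multidegree \<open>a\<close>, which has one scalar for each basis
  element whose label divides \<open>a\<close>; \<open>lift\<close> puts such scalars back.\<close>

definition strand :: "nat \<Rightarrow> 'x mono \<Rightarrow> ('b \<Rightarrow>\<^sub>0 ('x, 'k) mpoly) \<Rightarrow> ('b \<Rightarrow>\<^sub>0 'k)" where
  "strand i a V = (\<Sum>e\<in>below a i. single e (lookup (lookup V e) (a - lab i e)))"

definition lift :: "nat \<Rightarrow> 'x mono \<Rightarrow> ('b \<Rightarrow>\<^sub>0 'k) \<Rightarrow> ('b \<Rightarrow>\<^sub>0 ('x, 'k) mpoly)" where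
  "lift i a v = (\<Sum>e\<in>basis G i. single e (single (a - lab i e) (lookup v e)))"

lemma lookup_strand:
  "lookup (strand i a V) e = (if e \<in> below a i then lookup (lookup V e) (a - lab i e) else 0)"
  using finite_basis by (simp add: strand_def lookup_sum lookup_single when_def)

lemma keys_strand: "keys (strand i a V) \<subseteq> below a i"
  by (auto simp: in_keys_iff lookup_strand split: if_splits)

lemma additive_strand: "additive (strand i a)"
  by (simp add: additive_def strand_def lookup_add single_add sum.distrib)

lemma lookup_lift:
  "lookup (lift i a v) e = (if e \<in> basis G i then single (a - lab i e) (lookup v e) else 0)"
  using finite_basis by (simp add: lift_def lookup_sum lookup_single when_def)

lemma lift_free_mod: "lift i a v \<in> free_mod G i"
  by (auto simp: free_mod_def in_keys_iff lookup_lift split: if_splits)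

lemma strand_lift:
  assumes "keys v \<subseteq> below b i"
  shows "strand i a (lift i b v) = (if a = b then v else 0)"
proof (rule poly_mapping_eqI)
  fix e
  show "lookup (strand i a (lift i b v)) e = lookup (if a = b then v else 0) e"
  proof (cases "e \<in> below b i")
    case False
    then have "lookup v e = 0" using assms by (auto simp: in_keys_iff)
    then show ?thesis by (auto simp: lookup_strand lookup_lift)
  next
    case True
    have "b - lab i e = a - lab i e \<longleftrightarrow> a = b" if "mono_dvd (lab i e) a"
      using that True mono_dvd_diff_add[of "lab i e" a] mono_dvd_diff_add[of "lab i e" b] by auto
    then show ?thesis using True by (auto simp: lookup_strand lookup_lift lookup_single when_def)
  qed
qed

text \<open>The coefficient of the monomial \<open>m\<close> at \<open>e\<close> is visible in
  multidegree \<open>m + lab i e\<close>.\<close>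

lemma strand_eqI:
  assumes "V \<in> free_mod G i" "W \<in> free_mod G i" "\<And>a. strand i a V = strand i a W"
  shows "V = W"
proof (intro poly_mapping_eqI)
  fix e m
  show "lookup (lookup V e) m = lookup (lookup W e) m"
  proof (cases "e \<in> basis G i")
    case True
    have "lookup (strand i (m + lab i e) V) e = lookup (strand i (m + lab i e) W) e"
      using assms(3) by simp
    then show ?thesis using True by (simp add: lookup_strand mono_dvd_add)
  next
    case False
    then have "e \<notin> keys V" "e \<notin> keys W" using assms by (auto simp: free_mod_def)
    then show ?thesis by (simp add: in_keys_iff)
  qed
qed

lemma finite_strands:
  shows "finite {a. strand i a V \<noteq> 0}"
proof (rule finite_subset)
  show "{a. strand i a V \<noteq> 0} \<subseteq> (\<Union>e\<in>basis G i. (\<lambda>m. m + lab i e) ` keys (lookup V e))"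
  proof
    fix a assume "a \<in> {a. strand i a V \<noteq> 0}"
    then have "keys (strand i a V) \<noteq> {}" by simp
    then obtain e where "e \<in> keys (strand i a V)" by blast
    then have e: "e \<in> below a i" "a - lab i e \<in> keys (lookup V e)"
      by (auto simp: lookup_strand in_keys_iff split: if_splits)
    then have "a = a - lab i e + lab i e" by (simp add: mono_dvd_diff_add)
    then show "a \<in> (\<Union>e\<in>basis G i. (\<lambda>m. m + lab i e) ` keys (lookup V e))" using e by blast
  qed
qed (use finite_basis in auto)

text \<open>Multiplication by the monomial entry moves the exponent \<open>a - lab (Suc i) e\<close>
  to \<open>a - lab i e'\<close>, so the differential preserves multidegrees and acts on each strand
  through the scalars.\<close>

lemma strand_differential:
  "strand i a (differential G (Suc i) V) = scalar_diff (basis G) c (Suc i) (strand (Suc i) a V)"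
proof (rule poly_mapping_eqI)
  fix e'
  show "lookup (strand i a (differential G (Suc i) V)) e'
      = lookup (scalar_diff (basis G) c (Suc i) (strand (Suc i) a V)) e'"
  proof (cases "e' \<in> basis G i")
    case False
    then show ?thesis by (simp add: lookup_strand lookup_scalar_diff[OF finite_basis])
  next
    case e': True
    have summand: "(if mono_dvd (lab i e') a then lookup (lookup V e * entry G (Suc i) e e') (a - lab i e') else 0)
        = lookup (strand (Suc i) a V) e * c (Suc i) e e'" if e: "e \<in> basis G (Suc i)" for e
    proof (cases "c (Suc i) e e' = 0")
      case True
      then show ?thesis by (simp add: entry_eq[OF e e'])
    next
      case False
      note dvd = c_dvd[OF e e' False]
      show ?thesis
      proof (cases "mono_dvd (lab (Suc i) e) a")
        case True
        then show ?thesis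
          using e dvd mono_ord.trans[OF dvd True] mono_diff_diff[OF dvd True]
          by (simp add: entry_eq[OF e e'] lookup_times_single lookup_strand)
      next
        case False
        then have "\<not> mono_dvd (lab (Suc i) e - lab i e') (a - lab i e')" if "mono_dvd (lab i e') a"
          using mono_dvd_of_diff[OF dvd that] by blast
        then show ?thesis using False
          by (simp add: entry_eq[OF e e'] lookup_times_single lookup_strand)
      qed
    qed
    have "lookup (strand i a (differential G (Suc i) V)) e'
        = (\<Sum>e\<in>basis G (Suc i). if mono_dvd (lab i e') a then lookup (lookup V e * entry G (Suc i) e e') (a - lab i e') else 0)"
      using e' by (simp add: lookup_strand lookup_differential[OF finite_basis] lookup_sum)
    also have "\<dots> = (\<Sum>e\<in>basis G (Suc i). lookup (strand (Suc i) a V) e * c (Suc i) e e')"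
      by (rule sum.cong[OF refl summand])
    finally show ?thesis using e' by (simp add: lookup_scalar_diff[OF finite_basis])
  qed
qed

lemma differential_free_mod: "differential G (Suc i) V \<in> free_mod G i"
  using keys_differential[OF finite_basis] by (simp add: free_mod_def)

lemma zero_free_mod: "0 \<in> free_mod G i"
  by (simp add: free_mod_def)

lemma strand_zero: "strand i a 0 = 0"
  by (rule additive.zero[OF additive_strand])

lemma differential_eq_0_iff:
  "differential G (Suc i) V = 0 \<longleftrightarrow> (\<forall>a. scalar_diff (basis G) c (Suc i) (strand (Suc i) a V) = 0)"
  using strand_eqI[OF differential_free_mod zero_free_mod, of i V]
  by (auto simp: strand_differential[symmetric] strand_zero)

text \<open>An element has only finitely many nonzero strands, so preimages found strand by strand
  can be lifted and added up.\<close>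

lemma in_image_differential_iff:
  assumes V: "V \<in> free_mod G i"
  shows "V \<in> differential G (Suc i) ` free_mod G (Suc i) \<longleftrightarrow>
    (\<forall>a. \<exists>w. keys w \<subseteq> below a (Suc i) \<and> scalar_diff (basis G) c (Suc i) w = strand i a V)"
proof
  assume "V \<in> differential G (Suc i) ` free_mod G (Suc i)"
  then obtain W where "V = differential G (Suc i) W" by blast
  then have "keys (strand (Suc i) a W) \<subseteq> below a (Suc i)
      \<and> scalar_diff (basis G) c (Suc i) (strand (Suc i) a W) = strand i a V" for a
    using keys_strand by (simp add: strand_differential)
  then show "\<forall>a. \<exists>w. keys w \<subseteq> below a (Suc i) \<and> scalar_diff (basis G) c (Suc i) w = strand i a V"
    by blast
next
  assume "\<forall>a. \<exists>w. keys w \<subseteq> below a (Suc i) \<and> scalar_diff (basis G) c (Suc i) w = strand i a V"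
  from choice[OF this] obtain w where w: "\<And>a. keys (w a) \<subseteq> below a (Suc i)"
      "\<And>a. scalar_diff (basis G) c (Suc i) (w a) = strand i a V"
    by blast
  \<comment> \<open>Where the strand is zero, the chosen \<open>w a\<close> may still be nonzero;
    summing over \<open>A\<close> replaces it by zero.\<close>
  define A where "A = {a. strand i a V \<noteq> 0}"
  have finA: "finite A" unfolding A_def by (rule finite_strands)
  define W where "W = (\<Sum>a\<in>A. lift (Suc i) a (w a))"
  have W: "W \<in> free_mod G (Suc i)"
  proof -
    have "keys (lift (Suc i) a (w a)) \<subseteq> basis G (Suc i)" for a
      using lift_free_mod[of "Suc i" a "w a"] by (simp add: free_mod_def)
    then show ?thesis unfolding W_def free_mod_def mem_Collect_eq by (intro keys_sum_subset)
  qed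
  have "strand (Suc i) b W = (if b \<in> A then w b else 0)" for b
    using finA by (simp add: W_def additive.sum[OF additive_strand] strand_lift[OF w(1)])
  then have "strand i b (differential G (Suc i) W) = strand i b V" for b
    by (simp add: strand_differential w(2) A_def additive.zero[OF additive_scalar_diff])
  then have "differential G (Suc i) W = V"
    by (rule strand_eqI[OF differential_free_mod V])
  then show "V \<in> differential G (Suc i) ` free_mod G (Suc i)" using W by blast
qed

end

section \<open>Minimal multigraded resolutions\<close>

text \<open>What a minimal resolution of R/M amounts to on scalars and labels. Strictness in
  \<open>c_sdvd\<close> is minimality, since equal labels would give a unit entry. Exactness is
  demanded for monomials of \<open>M\<close> only, because by \<open>lab_in_ideal\<close> only
  \<open>e0\<close> contributes to the other multidegrees. The unit ideal is excluded: its minimal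
  resolution is zero and has no \<open>e0\<close>.\<close>

locale multigraded_resolution = based_complex B c e0
  for B :: "nat \<Rightarrow> 'b set" and c :: "nat \<Rightarrow> 'b \<Rightarrow> 'b \<Rightarrow> 'k::field" and e0 :: 'b +
  fixes lab :: "nat \<Rightarrow> 'b \<Rightarrow> 'x::finite mono" and M :: "('x, 'k) mpoly set"
  assumes M: "monomial_ideal M" and M_proper: "M \<noteq> UNIV"
    and lab_e0: "lab 0 e0 = 0"
    and c_sdvd: "e \<in> B (Suc i) \<Longrightarrow> e' \<in> B i \<Longrightarrow> c (Suc i) e e' \<noteq> 0 \<Longrightarrow>
      mono_sdvd (lab i e') (lab (Suc i) e)"
    and lab_in_ideal: "e \<in> B (Suc i) \<Longrightarrow> monom_poly (lab (Suc i) e) \<in> M"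
    and exact: "monom_poly a \<in> M \<Longrightarrow> exact_on B c (\<lambda>i. {e \<in> B i. mono_dvd (lab i e) a})"
begin

lemma one_notin: "monom_poly 0 \<notin> M"
  using monomial_ideal_one_iff[OF M] M_proper by blast

lemma lab_nonzero: "e \<in> B (Suc i) \<Longrightarrow> lab (Suc i) e \<noteq> 0"
  using lab_in_ideal one_notin by metis

text \<open>
  If the boundary of \<open>e\<close> were also the boundary of some \<open>w\<close> with labels properly below the label of
  \<open>e\<close>, then \<open>e - w\<close> would be a boundary, which minimality forbids.
\<close>

lemma not_exact_below_label:
  assumes e: "e \<in> B (Suc i)"
    and S: "\<And>j. S j \<subseteq> {e' \<in> B j. mono_sdvd (lab j e') (lab (Suc i) e)}"
    and below: "{e' \<in> B i. mono_sdvd (lab i e') (lab (Suc i) e)} \<subseteq> S i"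
  shows "\<not> exact_on B c S"
proof
  assume ex: "exact_on B c S"
  define a where "a = lab (Suc i) e"
  interpret d: additive "sd (Suc i)" by (rule additive_scalar_diff)
  have "keys (sd (Suc i) (single e 1)) \<subseteq> S i"
    by (rule keys_scalar_diff_subset) (use below c_sdvd in \<open>auto split: if_splits\<close>)
  moreover have "i = 0 \<or> sd i (sd (Suc i) (single e 1)) = 0"
    by (cases i) (auto simp: scalar_diff_scalar_diff)
  ultimately obtain w where w: "keys w \<subseteq> S (Suc i)" "sd (Suc i) w = sd (Suc i) (single e 1)"
    using ex unfolding exact_on_def by blast
  \<comment> \<open>Labels in \<open>S\<close> differ from the label of \<open>e\<close>, so
    subtracting \<open>w\<close> cannot cancel \<open>e\<close>.\<close>
  have we: "lookup w e = 0"
    using w(1) S[of "Suc i"] by (auto simp: in_keys_iff mono_sdvd_def subset_iff)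
  have "sd (Suc i) (single e 1 - w) = 0" using w(2) by (simp add: d.diff)
  moreover have "keys (single e 1 - w) \<subseteq> {e \<in> B (Suc i). mono_dvd (lab (Suc i) e) a}"
  proof -
    have "keys w \<subseteq> {e \<in> B (Suc i). mono_dvd (lab (Suc i) e) a}"
      using w(1) S[of "Suc i"] by (auto simp: a_def mono_sdvd_def subset_iff)
    moreover have "keys (single e (1 :: 'k)) \<subseteq> {e \<in> B (Suc i). mono_dvd (lab (Suc i) e) a}"
      using e mono_ord.refl by (simp add: a_def)
    ultimately show ?thesis by (meson subset_trans[OF keys_diff Un_least])
  qed
  ultimately obtain u where u: "keys u \<subseteq> {e \<in> B (Suc (Suc i)). mono_dvd (lab (Suc (Suc i)) e) a}"
      "sd (Suc (Suc i)) u = single e 1 - w"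
    using exact[OF lab_in_ideal[OF e]] unfolding exact_on_def a_def by blast
  have "e \<notin> keys (sd (Suc (Suc i)) u)"
  proof -
    have "keys (sd (Suc (Suc i)) u) \<subseteq> - {e}"
    proof (rule keys_scalar_diff_subset)
      fix f e' assume f: "f \<in> keys u" "f \<in> B (Suc (Suc i))" "e' \<in> B (Suc i)" "c (Suc (Suc i)) f e' \<noteq> 0"
      have "mono_dvd (lab (Suc (Suc i)) f) a" using u(1) f(1) by blast
      moreover have "mono_sdvd (lab (Suc i) e') (lab (Suc (Suc i)) f)" by (rule c_sdvd[OF f(2-)])
      ultimately have "lab (Suc i) e' \<noteq> a" by (auto simp: mono_sdvd_def dest: mono_ord.antisym)
      then show "e' \<in> - {e}" by (auto simp: a_def)
    qed
    then show ?thesis by blast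
  qed
  moreover have "lookup (single e 1 - w) e = 1" by (simp add: lookup_minus we)
  ultimately show False using u(2) by (simp add: in_keys_iff)
qed

text \<open>By induction all labels properly below \<open>a\<close> lie in the lattice, hence divide
  \<open>b\<close>, the lcm of the generators dividing \<open>a\<close>. If \<open>b\<close> were a
  proper divisor of \<open>a\<close>, exactness at \<open>b\<close> would be exactness properly
  below a label, which is impossible.\<close>

lemma label_in_lcm_lattice:
  assumes "e \<in> B i"
  shows "lab i e \<in> lcm_lattice M"
proof -
  have "\<forall>i e. e \<in> B i \<longrightarrow> lab i e = a \<longrightarrow> a \<in> lcm_lattice M" for a
  proof (induction a rule: wfp_induct_rule[OF wf_mono_sdvd])
    case (1 a)
    show ?case
    proof (intro allI impI)
      fix i e assume e: "e \<in> B i" "lab i e = a"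
      show "a \<in> lcm_lattice M"
      proof (cases i)
        case 0
        then show ?thesis using e B0 lab_e0 lcm_lattice_zero[OF M] by simp
      next
        case (Suc j)
        define b where "b = lcm_below M a"
        have bM: "monom_poly b \<in> M"
          unfolding b_def using lab_in_ideal e lcm_below_in_ideal[OF M] by (auto simp: Suc)
        have ba: "mono_dvd b a" unfolding b_def by (rule lcm_below_dvd[OF M])
        have below_b: "mono_dvd (lab k f) b" if "f \<in> B k" "mono_sdvd (lab k f) a" for f k
          using 1 that dvd_lcm_below[OF M, of "lab k f" a] unfolding b_def by (auto simp: mono_sdvd_def)
        show ?thesis
        proof (rule ccontr)
          assume "a \<notin> lcm_lattice M"
          then have bsa: "mono_sdvd b a"
            using lcm_below_lcm_lattice[OF M, of a] ba by (auto simp: b_def mono_sdvd_def)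
          have la: "lab (Suc j) e = a" using e(2) Suc by simp
          have "\<not> exact_on B c (\<lambda>k. {f \<in> B k. mono_dvd (lab k f) b})"
          proof (rule not_exact_below_label[of e j])
            show "e \<in> B (Suc j)" using e Suc by simp
            show "{f \<in> B k. mono_dvd (lab k f) b} \<subseteq> {f \<in> B k. mono_sdvd (lab k f) (lab (Suc j) e)}" for k
              unfolding la using mono_ord.strict_trans1[OF _ bsa] by blast
            show "{f \<in> B j. mono_sdvd (lab j f) (lab (Suc j) e)} \<subseteq> {f \<in> B j. mono_dvd (lab j f) b}"
              unfolding la using below_b by blast
          qed
          then show False using exact[OF bM] by blast
        qed
      qed
    qed
  qed
  then show ?thesis using assms by blast
qed

end

subsection \<open>The Betti poset\<close>

lemma acyclic_if_notin_betti_poset: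
  fixes M :: "('x::finite, 'k::field) mpoly set"
  assumes p: "p \<in> lcm_lattice M" "p \<notin> betti_poset M"
    and y: "keys y \<subseteq> {\<sigma> \<in> lower_complex M p. card \<sigma> = i}" "simplicial_boundary mono_sdvd y = 0"
  shows "\<exists>u :: 'x mono set \<Rightarrow>\<^sub>0 'k. keys u \<subseteq> {\<sigma> \<in> lower_complex M p. card \<sigma> = Suc i} \<and> simplicial_boundary mono_sdvd u = y"
proof -
  let ?K = "lower_complex M p"
  \<comment> \<open>Faces with \<open>i\<close> vertices have dimension
    \<open>int i - 1\<close>.\<close>
  let ?bs = "simplicial_boundaries mono_sdvd ?K (int i - 1) :: ('x mono set \<Rightarrow>\<^sub>0 'k) set"
  have "(reduced_homology mono_sdvd ?K (int i - 1) :: ('x mono set \<Rightarrow>\<^sub>0 'k) set set) = {?bs}"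
    using p by (auto simp: betti_poset_def)
  moreover have "y \<in> simplicial_cycles mono_sdvd ?K (int i - 1)"
    using y by (auto simp: simplicial_cycles_def simplicial_chains_def)
  ultimately have "coset ?bs y = ?bs"
    unfolding reduced_homology_def quot_def by blast
  moreover have "0 \<in> ?bs"
    unfolding simplicial_boundaries_def simplicial_chains_def
    by (rule image_eqI[where x = 0]) auto
  ultimately have "y \<in> ?bs" unfolding coset_def by force
  then obtain u where u: "y = simplicial_boundary mono_sdvd u"
      "keys u \<subseteq> {\<sigma> \<in> ?K. int (card \<sigma>) = int i + 1}"
    by (auto simp: simplicial_boundaries_def simplicial_chains_def)
  have "int (card \<sigma>) = int i + 1 \<longleftrightarrow> card \<sigma> = Suc i" for \<sigma> :: "'x mono set" by linarith
  then show ?thesis using u by auto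
qed

text \<open>The open interval below 1 is empty, and the complex consisting of the empty face has
  homology in degree -1.\<close>

lemma zero_in_betti_poset:
  fixes M :: "('x::finite, 'k::field) mpoly set"
  assumes "monomial_ideal M"
  shows "0 \<in> betti_poset M"
proof -
  have K: "lower_complex M 0 = {{}}"
    by (auto simp: lower_complex_def order_complex_def mono_sdvd_def)
  let ?bs = "simplicial_boundaries mono_sdvd (lower_complex M 0) (-1) :: ('x mono set \<Rightarrow>\<^sub>0 'k) set"
  have bs: "?bs = {0}"
  proof -
    have "(simplicial_chains {{}} 0 :: ('x mono set \<Rightarrow>\<^sub>0 'k) set) = {0}"
    proof -
      have "{\<sigma> \<in> {{}}. int (card \<sigma>) = 0 + 1} = ({} :: 'x mono set set)" by auto
      then show ?thesis unfolding simplicial_chains_def by (simp only: subset_empty keys_eq_empty) simp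
    qed
    then show ?thesis by (simp add: simplicial_boundaries_def K)
  qed
  let ?y = "single {} 1 :: 'x mono set \<Rightarrow>\<^sub>0 'k"
  have "?y \<in> simplicial_cycles mono_sdvd (lower_complex M 0) (-1)"
    by (simp add: simplicial_cycles_def simplicial_chains_def K simplicial_boundary_single)
  then have "coset ?bs ?y \<in> reduced_homology mono_sdvd (lower_complex M 0) (-1)"
    unfolding reduced_homology_def quot_def by blast
  moreover have "coset ?bs ?y \<noteq> ?bs"
    unfolding bs coset_def by (simp add: poly_mapping_eq_iff fun_eq_iff lookup_single when_def)
  ultimately have "(reduced_homology mono_sdvd (lower_complex M 0) (-1) :: ('x mono set \<Rightarrow>\<^sub>0 'k) set set) \<noteq> {?bs}"
    by blast
  then show ?thesis using lcm_lattice_zero[OF assms] unfolding betti_poset_def by blast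
qed

text \<open>Applies the comparison to the open interval from 1 to \<open>p\<close>. It serves both
  the original labels over \<open>M\<close> and the new labels over \<open>N\<close>, so
  \<open>lab_L\<close> and \<open>exact\<close> only concern what lies properly below
  \<open>p\<close>.\<close>

lemma exact_below_if_notin_betti_poset:
  fixes N :: "('x::finite, 'k::field) mpoly set" and lab :: "nat \<Rightarrow> 'b \<Rightarrow> 'x mono"
    and c :: "nat \<Rightarrow> 'b \<Rightarrow> 'b \<Rightarrow> 'k"
  assumes "based_complex B c e0" and N: "monomial_ideal N"
    and p: "p \<in> lcm_lattice N" "p \<notin> betti_poset N"
    and lab0: "lab 0 e0 = 0"
    and lab_L: "\<And>i e. e \<in> B (Suc i) \<Longrightarrow> mono_sdvd (lab (Suc i) e) p \<Longrightarrow> lab (Suc i) e \<in> lcm_lattice N - {0}"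
    and c_dvd: "\<And>i e e'. e \<in> B (Suc i) \<Longrightarrow> e' \<in> B i \<Longrightarrow> c (Suc i) e e' \<noteq> 0 \<Longrightarrow>
      mono_dvd (lab i e') (lab (Suc i) e)"
    and exact: "\<And>q. q \<in> lcm_lattice N \<Longrightarrow> q \<noteq> 0 \<Longrightarrow> mono_sdvd q p \<Longrightarrow>
      exact_on B c (\<lambda>i. {e \<in> B i. mono_dvd (lab i e) q})"
  shows "exact_on B c (\<lambda>i. {e \<in> B i. mono_sdvd (lab i e) p})"
proof -
  define P where "P = {q \<in> lcm_lattice N. mono_sdvd 0 q \<and> mono_sdvd q p}"
  \<comment> \<open>As 1 is in the Betti poset, \<open>p\<close> is not 1. So \<open>e0\<close>,
    labelled 1, lies properly below \<open>p\<close>, in agreement with degree 0 of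
    \<open>labels_in\<close>.\<close>
  have p0: "mono_sdvd 0 p"
    using p(2) zero_in_betti_poset[OF N] by (auto simp: mono_sdvd_def)
  interpret based_complex B c e0 by fact
  have lab_P_iff: "lab (Suc i) e \<in> P \<longleftrightarrow> mono_sdvd (lab (Suc i) e) p" if "e \<in> B (Suc i)" for e i
    using lab_L[OF that] by (auto simp: P_def mono_sdvd_def)
  interpret labelled_complex B c e0 mono_dvd mono_sdvd lab P
  proof unfold_locales
    show "finite P" using finite_lcm_lattice[OF N] by (simp add: P_def)
  next
    fix e e' i
    assume *: "e \<in> B (Suc (Suc i))" "lab (Suc (Suc i)) e \<in> P" "e' \<in> B (Suc i)" "c (Suc (Suc i)) e e' \<noteq> 0"
    have "mono_dvd (lab (Suc i) e') (lab (Suc (Suc i)) e)" by (rule c_dvd[OF *(1,3,4)])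
    moreover have "mono_sdvd (lab (Suc (Suc i)) e) p" using * lab_P_iff by blast
    ultimately show "lab (Suc i) e' \<in> P \<and> mono_dvd (lab (Suc i) e') (lab (Suc (Suc i)) e)"
      using lab_P_iff[OF *(3)] mono_ord.strict_trans1 by blast
  qed
  have "labels_in lab P = (\<lambda>i. {e \<in> B i. mono_sdvd (lab i e) p})"
  proof
    fix i show "labels_in lab P i = {e \<in> B i. mono_sdvd (lab i e) p}"
    proof (cases i)
      case 0
      then show ?thesis using B0 lab0 p0 by (auto simp: labels_in_def)
    next
      case (Suc j)
      then show ?thesis using lab_P_iff by (auto simp: labels_in_def)
    qed
  qed
  moreover have "exact_on B c (labels_in lab P)"
  proof (rule exact_on_labels_in)
    fix q assume q: "q \<in> P"
    then have qp: "mono_sdvd q p" and q0: "q \<noteq> 0" and qL: "q \<in> lcm_lattice N"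
      by (auto simp: P_def mono_sdvd_def)
    have "labels_in lab {r \<in> P. mono_dvd r q} = (\<lambda>i. {e \<in> B i. mono_dvd (lab i e) q})"
    proof
      fix i show "labels_in lab {r \<in> P. mono_dvd r q} i = {e \<in> B i. mono_dvd (lab i e) q}"
      proof (cases i)
        case 0
        then show ?thesis using B0 lab0 by (auto simp: labels_in_def)
      next
        case (Suc j)
        then show ?thesis using lab_P_iff mono_ord.strict_trans1[OF _ qp] unfolding labels_in_def by blast
      qed
    qed
    then show "exact_on B c (labels_in lab {r \<in> P. mono_dvd r q})" using exact[OF qL q0 qp] by simp
  next
    fix i and y :: "'x mono set \<Rightarrow>\<^sub>0 'k"
    assume "keys y \<subseteq> {\<sigma> \<in> order_complex mono_dvd P. card \<sigma> = i}" "simplicial_boundary mono_sdvd y = 0"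
    then show "\<exists>u. keys u \<subseteq> {\<sigma> \<in> order_complex mono_dvd P. card \<sigma> = Suc i} \<and> simplicial_boundary mono_sdvd u = y"
      using acyclic_if_notin_betti_poset[OF p] by (simp add: lower_complex_def P_def)
  qed
  ultimately show ?thesis by simp
qed

section \<open>Labels in the Betti poset and transport along the isomorphism\<close>

context multigraded_resolution
begin

text \<open>Otherwise the comparison would make the part properly below the label exact, against
  \<open>not_exact_below_label\<close>.\<close>

lemma label_in_betti_poset:
  assumes "e \<in> B i"
  shows "lab i e \<in> betti_poset M"
proof (cases i)
  case 0
  then show ?thesis using assms B0 lab_e0 zero_in_betti_poset[OF M] by simp
next
  case (Suc j)
  have e: "e \<in> B (Suc j)" using assms Suc by simp
  show ?thesis
  proof (rule ccontr)
    assume notin: "lab i e \<notin> betti_poset M"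
    have "exact_on B c (\<lambda>k. {f \<in> B k. mono_sdvd (lab k f) (lab i e)})"
    proof (rule exact_below_if_notin_betti_poset[where lab = lab and ?e0.0 = e0, OF _ M _ notin lab_e0])
      show "based_complex B c e0" by unfold_locales
      show "lab i e \<in> lcm_lattice M" by (rule label_in_lcm_lattice[OF assms])
      show "lab (Suc k) f \<in> lcm_lattice M - {0}" if "f \<in> B (Suc k)" for k f
        using label_in_lcm_lattice[OF that] lab_nonzero[OF that] by blast
      show "mono_dvd (lab k f') (lab (Suc k) f)"
        if "f \<in> B (Suc k)" "f' \<in> B k" "c (Suc k) f f' \<noteq> 0" for k f f'
        using c_sdvd[OF that] by (simp add: mono_sdvd_def)
      show "exact_on B c (\<lambda>k. {f \<in> B k. mono_dvd (lab k f) q})" if "q \<in> lcm_lattice M" "q \<noteq> 0" for q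
        using lcm_lattice_in_ideal[OF M that] by (rule exact)
    qed
    then show False using not_exact_below_label[OF e, of "\<lambda>k. {f \<in> B k. mono_sdvd (lab k f) (lab i e)}"] Suc by simp
  qed
qed

lemma relabel_multigraded_resolution:
  fixes N :: "('y::finite, 'k) mpoly set"
  assumes N: "monomial_ideal N" "N \<noteq> UNIV"
    and g: "poset_iso mono_dvd (betti_poset M) mono_dvd (betti_poset N) g"
  shows "multigraded_resolution B c e0 (\<lambda>i e. g (lab i e)) N"
proof -
  have g_dvd: "mono_dvd (g p) (g q) \<longleftrightarrow> mono_dvd p q" if "p \<in> betti_poset M" "q \<in> betti_poset M" for p q
    using g that by (simp add: poset_iso_def)
  have g_bij: "bij_betw g (betti_poset M) (betti_poset N)" using g by (simp add: poset_iso_def)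
  have g_in: "g p \<in> betti_poset N" if "p \<in> betti_poset M" for p
    using g_bij that bij_betwE by blast
  have g_eq: "g p = g q \<longleftrightarrow> p = q" if "p \<in> betti_poset M" "q \<in> betti_poset M" for p q
    using g_bij that by (auto simp: bij_betw_def inj_on_def)
  \<comment> \<open>1 lies in both Betti posets, and an order isomorphism preserves least
    elements.\<close>
  have g0: "g 0 = 0"
  proof -
    obtain q where q: "q \<in> betti_poset M" "g q = 0"
      using g_bij zero_in_betti_poset[OF N(1)] by (metis bij_betw_iff_bijections)
    have "mono_dvd (g 0) (g q)" using g_dvd[OF zero_in_betti_poset[OF M] q(1)] by simp
    then show ?thesis using q(2) by simp
  qed
  let ?l = "\<lambda>i e. g (lab i e)"
  have lab_L: "?l i e \<in> lcm_lattice N" if "e \<in> B i" for i e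
    using g_in[OF label_in_betti_poset[OF that]] by (simp add: betti_poset_def)
  have lab_nz: "?l (Suc i) e \<noteq> 0" if "e \<in> B (Suc i)" for i e
    using g_eq[OF label_in_betti_poset[OF that] zero_in_betti_poset[OF M]] lab_nonzero[OF that] g0 by simp
  have sdvd: "mono_sdvd (?l i e') (?l (Suc i) e)"
    if "e \<in> B (Suc i)" "e' \<in> B i" "c (Suc i) e e' \<noteq> 0" for i e e'
    using c_sdvd[OF that] g_dvd[OF label_in_betti_poset label_in_betti_poset, OF that(2,1)]
      g_eq[OF label_in_betti_poset label_in_betti_poset, OF that(2,1)] by (simp add: mono_sdvd_def)
  have exact_L: "q \<in> lcm_lattice N \<longrightarrow> q \<noteq> 0 \<longrightarrow> exact_on B c (\<lambda>i. {e \<in> B i. mono_dvd (?l i e) q})" for q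
  proof (induction q rule: wfp_induct_rule[OF wf_mono_sdvd])
    case (1 q)
    show ?case
    proof (intro impI)
      assume q: "q \<in> lcm_lattice N" "q \<noteq> 0"
      show "exact_on B c (\<lambda>i. {e \<in> B i. mono_dvd (?l i e) q})"
      proof (cases "q \<in> betti_poset N")
        case True
        then obtain p where p: "p \<in> betti_poset M" "q = g p"
          using g_bij by (metis bij_betw_iff_bijections)
        \<comment> \<open>Since \<open>p\<close> is a lattice element other than 1, it lies in
          \<open>M\<close>, where exactness is available.\<close>
        then have "p \<noteq> 0" "p \<in> lcm_lattice M" using q(2) g0 by (auto simp: betti_poset_def)
        then have "exact_on B c (\<lambda>i. {e \<in> B i. mono_dvd (lab i e) p})"
          by (intro exact lcm_lattice_in_ideal[OF M])
        moreover have "{e \<in> B i. mono_dvd (lab i e) p} = {e \<in> B i. mono_dvd (?l i e) q}" for i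
          using g_dvd[OF label_in_betti_poset p(1)] p(2) by auto
        ultimately show ?thesis by simp
      next
        case False
        have "exact_on B c (\<lambda>i. {e \<in> B i. mono_sdvd (?l i e) q})"
        proof (rule exact_below_if_notin_betti_poset[where lab = ?l and ?e0.0 = e0, OF _ N(1) q(1) False])
          show "based_complex B c e0" by unfold_locales
          show "?l 0 e0 = 0" by (simp add: lab_e0 g0)
          show "?l (Suc i) e \<in> lcm_lattice N - {0}" if "e \<in> B (Suc i)" for i e
            using lab_L[OF that] lab_nz[OF that] by blast
          show "mono_dvd (?l i e') (?l (Suc i) e)"
            if "e \<in> B (Suc i)" "e' \<in> B i" "c (Suc i) e e' \<noteq> 0" for i e e'
            using sdvd[OF that] by (simp add: mono_sdvd_def)
          show "exact_on B c (\<lambda>i. {e \<in> B i. mono_dvd (?l i e) r})"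
            if "r \<in> lcm_lattice N" "r \<noteq> 0" "mono_sdvd r q" for r
            using 1 that by blast
        qed
        moreover have "{e \<in> B i. mono_sdvd (?l i e) q} = {e \<in> B i. mono_dvd (?l i e) q}" for i
          using g_in[OF label_in_betti_poset] False by (auto simp: mono_sdvd_def)
        ultimately show ?thesis by simp
      qed
    qed
  qed
  show ?thesis
  proof unfold_locales
    show "monomial_ideal N" "N \<noteq> UNIV" by (fact N)+
    show "?l 0 e0 = 0" by (simp add: lab_e0 g0)
    show "mono_sdvd (?l i e') (?l (Suc i) e)"
      if "e \<in> B (Suc i)" "e' \<in> B i" "c (Suc i) e e' \<noteq> 0" for i e e' by (rule sdvd[OF that])
    show "monom_poly (?l (Suc i) e) \<in> N" if "e \<in> B (Suc i)" for i e
      using lcm_lattice_in_ideal[OF N(1) lab_L[OF that] lab_nz[OF that]] .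
    show "exact_on B c (\<lambda>i. {e \<in> B i. mono_dvd (?l i e) b})" if b: "monom_poly b \<in> N" for b
    proof -
      \<comment> \<open>The new labels lie in the lcm-lattice, so those dividing \<open>b\<close>
        are those dividing \<open>?b\<close>; and \<open>?b\<close> is not 1 because
        \<open>N\<close> is proper.\<close>
      let ?b = "lcm_below N b"
      have "monom_poly ?b \<in> N" by (rule lcm_below_in_ideal[OF N(1) b])
      then have "?b \<noteq> 0" using monomial_ideal_one_iff[OF N(1)] N(2) by metis
      then have "exact_on B c (\<lambda>i. {e \<in> B i. mono_dvd (?l i e) ?b})"
        using exact_L lcm_below_lcm_lattice[OF N(1)] by blast
      moreover have "mono_dvd (?l i e) ?b \<longleftrightarrow> mono_dvd (?l i e) b" if "e \<in> B i" for i e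
        using dvd_lcm_below[OF N(1) lab_L[OF that]] lcm_below_dvd[OF N(1)] mono_ord.trans by blast
      then have "{e \<in> B i. mono_dvd (?l i e) ?b} = {e \<in> B i. mono_dvd (?l i e) b}" for i
        by blast
      ultimately show ?thesis by simp
    qed
  qed
qed

end

section \<open>From free resolutions to labelled complexes and back\<close>

lemma coset_eq_ideal_iff:
  fixes M :: "('x::finite, 'k::field) mpoly set"
  assumes "monomial_ideal M"
  shows "coset M p = M \<longleftrightarrow> p \<in> M"
proof
  assume "coset M p = M"
  moreover have "p \<in> coset M p"
    unfolding coset_def using monomial_ideal_zero[OF assms] by force
  ultimately show "p \<in> M" by simp
next
  assume p: "p \<in> M"
  note diff = monomial_ideal_diff[OF assms]
  have "p + b \<in> M" if "b \<in> M" for b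
    using diff[OF p diff[OF diff[OF that that] that]] by simp
  moreover have "b \<in> (\<lambda>b. p + b) ` M" if "b \<in> M" for b
    using diff[OF that p] by (intro image_eqI[of _ _ "b - p"]) auto
  ultimately show "coset M p = M" unfolding coset_def by blast
qed

lemma lookup_mono_of: "(\<And>x. a x \<ge> 0) \<Longrightarrow> int (lookup (mono_of a) x) = a x" for a :: "'x::finite \<Rightarrow> int"
  unfolding mono_of_def by (subst lookup_Abs_poly_mapping) auto

lemma times_irrelevant_ideal:
  fixes p q :: "('x, 'k::field) mpoly"
  shows "lookup q 0 = 0 \<Longrightarrow> lookup (p * q) 0 = 0"
  using mpoly_module.span_scale[of q _ p]
  by (simp add: irrelevant_ideal_iff[symmetric] irrelevant_ideal_def ideal_gen_def)

section \<open>Scalars and labels extracted from a minimal free resolution\<close>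

context
  fixes F :: "('b, 'x::finite, 'k::field) based_seq" and M :: "('x, 'k) mpoly set"
  assumes F: "minimal_free_resolution F M"
begin

lemma resolution_finite_basis: "finite (basis F i)"
  using F by (simp add: minimal_free_resolution_def free_resolution_def graded_free_seq_def)

lemma resolution_homogeneous:
  "e \<in> basis F (Suc i) \<Longrightarrow> e' \<in> basis F i \<Longrightarrow>
    homogeneous (\<lambda>x. mdeg F (Suc i) e x - mdeg F i e' x) (entry F (Suc i) e e')"
  using F by (simp add: minimal_free_resolution_def free_resolution_def graded_free_seq_def)

lemma resolution_exact:
  "{v \<in> free_mod F (Suc i). differential F (Suc i) v = 0} = differential F (Suc (Suc i)) ` free_mod F (Suc (Suc i))"
  using F by (simp add: minimal_free_resolution_def free_resolution_def)

lemma resolution_minimal: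
  assumes "V \<in> differential F (Suc i) ` free_mod F (Suc i)" "e \<in> basis F i"
  shows "lookup (lookup V e) 0 = 0"
  using F assms by (auto simp: minimal_free_resolution_def irrelevant_ideal_iff)

text \<open>If all entries vanished, \<open>e\<close> would be a cycle, hence a boundary with
  coefficient 1 at \<open>e\<close>, against minimality.\<close>

lemma resolution_entry_nonzero:
  assumes e: "e \<in> basis F (Suc i)"
  shows "\<exists>e'\<in>basis F i. entry F (Suc i) e e' \<noteq> 0"
proof (rule ccontr)
  assume "\<not> ?thesis"
  then have "lookup (differential F (Suc i) (single e 1)) e' = 0" for e'
    by (simp add: differential_single[OF resolution_finite_basis resolution_finite_basis e])
  then have "differential F (Suc i) (single e 1) = 0" by (intro poly_mapping_eqI) simp
  then have "single e 1 \<in> differential F (Suc (Suc i)) ` free_mod F (Suc (Suc i))"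
    using e resolution_exact[of i] by (auto simp: free_mod_def)
  from resolution_minimal[OF this e] show False by simp
qed

text \<open>The augmentation is zero, so degree 0 consists of boundaries, which minimality permits
  only in rank 0. Higher up, a basis element would need a nonzero entry into an empty basis.\<close>

lemma resolution_of_unit_ideal:
  assumes "M = UNIV"
  shows "basis F i = {}"
proof (induction i)
  case 0
  obtain \<epsilon> where "{v \<in> free_mod F 0. augmentation F M \<epsilon> v = M} = differential F 1 ` free_mod F 1"
    using F by (auto simp: minimal_free_resolution_def free_resolution_def)
  moreover have "augmentation F M \<epsilon> v = M" for v
    unfolding augmentation_def coset_def assms by (metis surj_plus)
  ultimately have im: "free_mod F 0 = differential F (Suc 0) ` free_mod F (Suc 0)" by simp
  show ?case
  proof (rule ccontr)
    assume "basis F 0 \<noteq> {}"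
    then obtain e where e: "e \<in> basis F 0" by blast
    then have "single e 1 \<in> free_mod F 0" by (simp add: free_mod_def)
    then show False using resolution_minimal[of "single e 1" 0 e] im e by simp
  qed
next
  case (Suc i)
  then show ?case using resolution_entry_nonzero[of _ i] by blast
qed

context
  assumes M: "monomial_ideal M" and M_proper: "M \<noteq> UNIV"
begin

text \<open>To hit the class of 1, some generator must have an image with nonzero constant term;
  homogeneity then forces multidegree 0 and a constant image.\<close>

lemma resolution_degree_zero:
  obtains e0 k \<epsilon> where "basis F 0 = {e0}" "mdeg F 0 e0 = (\<lambda>_. 0)" "k \<noteq> 0" "\<epsilon> e0 = single 0 k"
    "{v \<in> free_mod F 0. augmentation F M \<epsilon> v = M} = differential F 1 ` free_mod F 1"
proof -
  have one: "monom_poly 0 \<notin> M" using monomial_ideal_one_iff[OF M] M_proper by blast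
  obtain \<epsilon> where hom: "\<forall>e\<in>basis F 0. homogeneous (mdeg F 0 e) (\<epsilon> e)"
    and surj: "augmentation F M \<epsilon> ` free_mod F 0 = quot UNIV M"
    and ker: "{v \<in> free_mod F 0. augmentation F M \<epsilon> v = M} = differential F 1 ` free_mod F 1"
    using F unfolding minimal_free_resolution_def free_resolution_def by (elim conjE exE)
  have "coset M 1 \<in> quot UNIV M" by (simp add: quot_def)
  then have "coset M 1 \<in> augmentation F M \<epsilon> ` free_mod F 0" by (simp only: surj)
  then obtain v where "coset M (\<Sum>e\<in>basis F 0. lookup v e * \<epsilon> e) = coset M 1"
    unfolding augmentation_def by (elim imageE) (rule that, simp)
  moreover have "1 \<in> coset M 1" unfolding coset_def using monomial_ideal_zero[OF M] by force
  ultimately obtain b where b: "b \<in> M" "1 = (\<Sum>e\<in>basis F 0. lookup v e * \<epsilon> e) + b"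
    unfolding coset_def by blast
  have "lookup b 0 = 0" using b(1) one monomial_ideal_iff[OF M, of b] by (metis in_keys_iff)
  then have "lookup (\<Sum>e\<in>basis F 0. lookup v e * \<epsilon> e) 0 = 1"
    using arg_cong[OF b(2), of "\<lambda>p. lookup p 0"] by (simp add: lookup_add)
  then have "(\<Sum>e\<in>basis F 0. lookup (lookup v e * \<epsilon> e) 0) \<noteq> 0" by (simp add: lookup_sum)
  then obtain e0 where e0: "e0 \<in> basis F 0" "lookup (lookup v e0 * \<epsilon> e0) 0 \<noteq> 0"
    by (meson sum.not_neutral_contains_not_neutral)
  define k where "k = lookup (\<epsilon> e0) 0"
  have k: "k \<noteq> 0" using e0(2) times_irrelevant_ideal[of "\<epsilon> e0" "lookup v e0"] by (auto simp: k_def)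
  then have "0 \<in> keys (\<epsilon> e0)" by (simp add: k_def in_keys_iff)
  then have mdeg: "mdeg F 0 e0 = (\<lambda>_. 0)"
    using hom e0(1) unfolding homogeneous_def by fastforce
  have "m = 0" if "m \<in> keys (\<epsilon> e0)" for m
    using hom e0(1) that mdeg unfolding homogeneous_def by (auto intro!: poly_mapping_eqI)
  then have \<epsilon>0: "\<epsilon> e0 = single 0 k"
    by (intro poly_mapping_eqI) (auto simp: k_def lookup_single when_def in_keys_iff)
  have "basis F 0 = {e0}"
  proof (rule ccontr)
    assume "basis F 0 \<noteq> {e0}"
    then obtain e1 where e1: "e1 \<in> basis F 0" "e1 \<noteq> e0" using e0(1) by blast
    \<comment> \<open>A second generator is redundant: \<open>V\<close> is in the kernel of the
      augmentation, hence a boundary, yet its coefficient at \<open>e1\<close> is 1.\<close>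
    define V where "V = single e1 1 - single e0 (\<epsilon> e1 * single 0 (inverse k))"
    have fm: "V \<in> free_mod F 0"
      using keys_diff[of "single e1 1" "single e0 (\<epsilon> e1 * single 0 (inverse k))"] e0(1) e1(1)
      by (auto simp: V_def free_mod_def split: if_splits)
    have "(\<Sum>e\<in>basis F 0. lookup V e * \<epsilon> e) = (\<Sum>e\<in>{e0, e1}. lookup V e * \<epsilon> e)"
      using resolution_finite_basis e0(1) e1(1)
      by (intro sum.mono_neutral_right) (auto simp: V_def lookup_minus lookup_single when_def)
    also have "\<dots> = \<epsilon> e1 - \<epsilon> e1 * (single 0 (inverse k) * single 0 k)"
    proof -
      have "lookup V e0 = - (\<epsilon> e1 * single 0 (inverse k))" "lookup V e1 = 1"
        using e1(2) by (simp_all add: V_def lookup_minus lookup_single when_def)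
      moreover have "(\<Sum>e\<in>{e0, e1}. lookup V e * \<epsilon> e) = lookup V e0 * \<epsilon> e0 + lookup V e1 * \<epsilon> e1"
        using e1(2) by simp
      ultimately show ?thesis unfolding \<epsilon>0 by (simp only: mult_minus_left mult_1_left mult.assoc uminus_add_conv_diff)
    qed
    also have "\<dots> = 0" using k by (simp add: mult_single)
    finally have "augmentation F M \<epsilon> V = M"
      using coset_eq_ideal_iff[OF M] monomial_ideal_zero[OF M] by (simp add: augmentation_def)
    then have "V \<in> differential F (Suc 0) ` free_mod F (Suc 0)" using ker fm by auto
    from resolution_minimal[OF this e1(1)] show False
      using e1(2) by (simp add: V_def lookup_minus lookup_single when_def)
  qed
  then show thesis using that mdeg k \<epsilon>0 ker by blast
qed

text \<open>Multidegrees are integer vectors a priori. They are nonnegative because each basis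
  element has a nonzero entry into the previous degree, and the exponents of that entry are
  differences of multidegrees.\<close>

lemma resolution_mdeg:
  assumes "e \<in> basis F i"
  shows "int (lookup (mono_of (mdeg F i e)) x) = mdeg F i e x"
proof -
  have "0 \<le> mdeg F i e x" for x
    using assms
  proof (induction i arbitrary: e)
    case 0
    then show ?case using resolution_degree_zero by (metis order_refl singletonD)
  next
    case (Suc i)
    obtain e' where e': "e' \<in> basis F i" "entry F (Suc i) e e' \<noteq> 0"
      using resolution_entry_nonzero[OF Suc.prems] by blast
    then obtain m where "m \<in> keys (entry F (Suc i) e e')" by (metis keys_eq_empty ex_in_conv)
    then have "int (lookup m x) = mdeg F (Suc i) e x - mdeg F i e' x"
      using resolution_homogeneous[OF Suc.prems e'(1)] by (simp add: homogeneous_def)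
    then show ?case using Suc.IH[OF e'(1)] by linarith
  qed
  then show ?thesis by (rule lookup_mono_of)
qed

abbreviation rlab :: "nat \<Rightarrow> 'b \<Rightarrow> 'x mono" where
  "rlab i e \<equiv> mono_of (mdeg F i e)"

lemma resolution_keys_entry:
  assumes e: "e \<in> basis F (Suc i)" and e': "e' \<in> basis F i" and m: "m \<in> keys (entry F (Suc i) e e')"
  shows "rlab (Suc i) e = m + rlab i e'"
proof (rule poly_mapping_eqI)
  fix x
  have "int (lookup m x) = mdeg F (Suc i) e x - mdeg F i e' x"
    using resolution_homogeneous[OF e e'] m by (simp add: homogeneous_def)
  then have "int (lookup (rlab (Suc i) e) x) = int (lookup (m + rlab i e') x)"
    by (simp add: lookup_add resolution_mdeg[OF e] resolution_mdeg[OF e'])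
  then show "lookup (rlab (Suc i) e) x = lookup (m + rlab i e') x" by linarith
qed

text \<open>Homogeneity leaves room for one monomial in each entry, and \<open>struct_coeff\<close>
  is its coefficient.\<close>

lemma resolution_monomial_matrices: "monomial_matrices F rlab (struct_coeff F)"
proof
  show "finite (basis F i)" for i by (rule resolution_finite_basis)
next
  fix e e' i
  assume e: "e \<in> basis F (Suc i)" and e': "e' \<in> basis F i"
  have "m = rlab (Suc i) e - rlab i e'" if "m \<in> keys (entry F (Suc i) e e')" for m
    using resolution_keys_entry[OF e e' that] by simp
  then show "entry F (Suc i) e e' = single (rlab (Suc i) e - rlab i e') (struct_coeff F (Suc i) e e')"
    by (intro poly_mapping_eqI) (auto simp: struct_coeff_def lookup_single when_def in_keys_iff)
  assume "struct_coeff F (Suc i) e e' \<noteq> 0"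
  then have "rlab (Suc i) e - rlab i e' \<in> keys (entry F (Suc i) e e')"
    by (simp add: struct_coeff_def in_keys_iff)
  from resolution_keys_entry[OF e e' this] show "mono_dvd (rlab i e') (rlab (Suc i) e)"
    by (metis mono_dvd_add)
qed

lemma resolution_multigraded:
  obtains e0 where "multigraded_resolution (basis F) (struct_coeff F) e0 rlab M"
proof -
  obtain e0 k \<epsilon> where B0: "basis F 0 = {e0}" and mdeg0: "mdeg F 0 e0 = (\<lambda>_. 0)" and k: "k \<noteq> 0"
    and \<epsilon>0: "\<epsilon> e0 = single 0 k"
    and ker: "{v \<in> free_mod F 0. augmentation F M \<epsilon> v = M} = differential F 1 ` free_mod F 1"
    by (rule resolution_degree_zero)
  interpret monomial_matrices F rlab "struct_coeff F" by (rule resolution_monomial_matrices)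
  let ?sd = "scalar_diff (basis F) (struct_coeff F)"
  have lab0: "rlab 0 e0 = 0"
    by (simp add: mdeg0 mono_of_def)
  \<comment> \<open>Lift a basis element to its own multidegree, apply the differential twice, and
    read off that strand.\<close>
  have dd0: "?sd (Suc i) (?sd (Suc (Suc i)) v) = 0" for i v
  proof -
    define f where "f v = ?sd (Suc i) (?sd (Suc (Suc i)) v)" for v
    have f: "additive f" unfolding f_def by (rule additive_compose[OF additive_scalar_diff additive_scalar_diff])
    have "f (single e r) = 0" for e r
    proof (cases "e \<in> basis F (Suc (Suc i))")
      case False
      then have "?sd (Suc (Suc i)) (single e r) = 0"
        unfolding scalar_diff_def by (intro sum.neutral ballI) (auto simp: lookup_single when_def)
      then show ?thesis by (simp add: f_def additive.zero[OF additive_scalar_diff])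
    next
      case True
      let ?a = "rlab (Suc (Suc i)) e" and ?V = "lift (Suc (Suc i)) (rlab (Suc (Suc i)) e) (single e r)"
      have "differential F (Suc (Suc i)) ?V \<in> {v \<in> free_mod F (Suc i). differential F (Suc i) v = 0}"
        using resolution_exact[of i] lift_free_mod by blast
      then have "strand i ?a (differential F (Suc i) (differential F (Suc (Suc i)) ?V)) = 0"
        by (simp add: strand_zero)
      moreover have "strand (Suc (Suc i)) ?a ?V = single e r"
        using True mono_ord.refl by (subst strand_lift) auto
      ultimately show ?thesis by (simp add: f_def strand_differential)
    qed
    then have "f v = 0" by (simp add: additive_sum_single[OF f, of v])
    then show ?thesis by (simp add: f_def)
  qed
  have aug: "augmentation F M \<epsilon> V = M \<longleftrightarrow> lookup V e0 * single 0 k \<in> M" for V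
    by (simp add: augmentation_def B0 \<epsilon>0 coset_eq_ideal_iff[OF M])
  have nz: "\<exists>e'\<in>basis F i. struct_coeff F (Suc i) e e' \<noteq> 0" if "e \<in> basis F (Suc i)" for i e
    using resolution_entry_nonzero[OF that] entry_eq[OF that] single_zero by (metis (no_types))
  \<comment> \<open>In degree 1 the image of \<open>e\<close> is in the kernel of the augmentation,
    so its coefficient at \<open>e0\<close>, a nonzero multiple of the monomial of the label, lies
    in \<open>M\<close>. Higher labels are multiples of lower ones.\<close>
  have lab_M: "monom_poly (rlab (Suc i) e) \<in> M" if "e \<in> basis F (Suc i)" for i e
    using that
  proof (induction i arbitrary: e)
    case 0
    have c: "struct_coeff F (Suc 0) e e0 \<noteq> 0" using nz[OF 0] B0 by simp
    have "single e 1 \<in> free_mod F 1" using 0 by (simp add: free_mod_def)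
    then have "lookup (differential F 1 (single e 1)) e0 * single 0 k \<in> M"
      using ker aug by blast
    moreover have "lookup (differential F 1 (single e 1)) e0 = single (rlab (Suc 0) e) (struct_coeff F (Suc 0) e e0)"
      using 0 B0 differential_single[OF finite_basis finite_basis 0, of 1 e0] entry_eq[OF 0, of e0]
      by (simp add: lab0)
    ultimately show ?case
      using c k monomial_ideal_single[OF M] by (simp add: mult_single)
  next
    case (Suc i)
    then obtain e' where "e' \<in> basis F (Suc i)" "struct_coeff F (Suc (Suc i)) e e' \<noteq> 0"
      using nz by blast
    then show ?case using Suc.IH c_dvd[OF Suc.prems] monomial_ideal_dvd[OF M] by blast
  qed
  have "multigraded_resolution (basis F) (struct_coeff F) e0 rlab M"
  proof
    show "finite (basis F i)" for i by (rule finite_basis)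
    show "basis F 0 = {e0}" by fact
    show "?sd (Suc i) (?sd (Suc (Suc i)) v) = 0" for i v by (rule dd0)
    show "monomial_ideal M" "M \<noteq> UNIV" by (fact M M_proper)+
    show "rlab 0 e0 = 0" by fact
    show "monom_poly (rlab (Suc i) e) \<in> M" if "e \<in> basis F (Suc i)" for i e by (rule lab_M[OF that])
  next
    fix e i e' assume e: "e \<in> basis F (Suc i)" "e' \<in> basis F i" "struct_coeff F (Suc i) e e' \<noteq> 0"
    \<comment> \<open>Equal labels would make the entry a nonzero constant, against
      minimality.\<close>
    have "rlab i e' \<noteq> rlab (Suc i) e"
    proof
      assume "rlab i e' = rlab (Suc i) e"
      then have "lookup (differential F (Suc i) (single e 1)) e' = single 0 (struct_coeff F (Suc i) e e')"
        using e differential_single[OF finite_basis finite_basis e(1), of 1 e'] entry_eq[OF e(1,2)] by simp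
      moreover have "differential F (Suc i) (single e 1) \<in> differential F (Suc i) ` free_mod F (Suc i)"
        using e(1) by (simp add: free_mod_def)
      ultimately show False using resolution_minimal e(2,3) by fastforce
    qed
    then show "mono_sdvd (rlab i e') (rlab (Suc i) e)" using c_dvd[OF e] by (simp add: mono_sdvd_def)
  next
    fix a assume a: "monom_poly a \<in> M"
    show "exact_on (basis F) (struct_coeff F) (below a)"
      unfolding exact_on_def
    proof (intro allI impI)
      fix i z assume z: "keys z \<subseteq> below a i" and cyc: "i = 0 \<or> ?sd i z = 0"
      \<comment> \<open>A cycle of scalars becomes a cycle of the resolution in multidegree
        \<open>a\<close>. In degree 0 the augmentation kills it because the monomial
        \<open>a\<close> lies in \<open>M\<close>.\<close>
      have "lift i a z \<in> differential F (Suc i) ` free_mod F (Suc i)"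
      proof (cases i)
        case 0
        have "lookup (lift 0 a z) e0 * single 0 k = single a (lookup z e0 * k)"
          by (simp add: lookup_lift B0 lab0 mult_single)
        moreover have "single a (lookup z e0 * k) \<in> M"
          using a monomial_ideal_single[OF M] monomial_ideal_zero[OF M] by (metis single_zero)
        ultimately have "augmentation F M \<epsilon> (lift 0 a z) = M" by (simp add: aug)
        then show ?thesis using ker lift_free_mod[of 0 a z] by (auto simp: 0)
      next
        case (Suc j)
        have "?sd i (strand i b (lift i a z)) = 0" for b
          unfolding strand_lift[OF z] using cyc Suc by (auto simp: additive.zero[OF additive_scalar_diff])
        then have "differential F (Suc j) (lift (Suc j) a z) = 0"
          by (simp add: differential_eq_0_iff Suc)
        then show ?thesis using resolution_exact[of j] lift_free_mod[of "Suc j" a z] by (auto simp: Suc)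
      qed
      then have "\<exists>w. keys w \<subseteq> below a (Suc i) \<and> ?sd (Suc i) w = strand i a (lift i a z)"
        using in_image_differential_iff[OF lift_free_mod] by blast
      then show "\<exists>w. keys w \<subseteq> below a (Suc i) \<and> ?sd (Suc i) w = z"
        by (simp add: strand_lift[OF z])
    qed
  qed
  then show thesis by (rule that)
qed

end

end

text \<open>Exactness is checked strand by strand. In multidegrees of \<open>M\<close> it is given;
  in the others only \<open>e0\<close> contributes, and it survives as the class of a monomial in
  R/M.\<close>

lemma (in multigraded_resolution) minimal_free_resolutionI:
  fixes G :: "('b, 'x, 'k) based_seq"
  assumes basis: "basis G = B"
    and mdeg: "\<And>i e x. e \<in> B i \<Longrightarrow> mdeg G i e x = int (lookup (lab i e) x)"
    and entry: "\<And>i e e'. e \<in> B (Suc i) \<Longrightarrow> e' \<in> B i \<Longrightarrow>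
      entry G (Suc i) e e' = single (lab (Suc i) e - lab i e') (c (Suc i) e e')"
  shows "minimal_free_resolution G M"
proof -
  interpret monomial_matrices G lab c
    by unfold_locales (use basis entry finite_B c_sdvd in \<open>auto simp: mono_sdvd_def\<close>)
  have homog: "graded_free_seq G"
    unfolding graded_free_seq_def
  proof (intro conjI allI ballI)
    show "finite (basis G i)" for i by (rule finite_basis)
    fix i e e' assume e: "e \<in> basis G (Suc i)" and e': "e' \<in> basis G i"
    show "homogeneous (\<lambda>x. mdeg G (Suc i) e x - mdeg G i e' x) (entry G (Suc i) e e')"
      unfolding homogeneous_def
    proof (intro ballI allI)
      fix m x assume "m \<in> keys (entry G (Suc i) e e')"
      then have m: "c (Suc i) e e' \<noteq> 0" "m = lab (Suc i) e - lab i e'"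
        by (auto simp: entry_eq[OF e e'] split: if_splits)
      have "lookup (lab i e') x \<le> lookup (lab (Suc i) e) x"
        using c_dvd[OF e e' m(1)] by (simp add: mono_dvd_def)
      then show "int (lookup m x) = mdeg G (Suc i) e x - mdeg G i e' x"
        using e e' by (simp add: m lookup_minus mdeg basis)
    qed
  qed
  define \<epsilon> :: "'b \<Rightarrow> ('x, 'k) mpoly" where "\<epsilon> e = 1" for e
  have aug: "augmentation G M \<epsilon> V = coset M (lookup V e0)" for V
    by (simp add: augmentation_def basis B0 \<epsilon>_def)
  have hom0: "\<forall>e\<in>basis G 0. homogeneous (mdeg G 0 e) (\<epsilon> e)"
    by (simp add: basis B0 homogeneous_def \<epsilon>_def mdeg lab_e0)
  have surj: "augmentation G M \<epsilon> ` free_mod G 0 = quot UNIV M"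
  proof -
    have "coset M p \<in> augmentation G M \<epsilon> ` free_mod G 0" for p
      by (rule image_eqI[of _ _ "single e0 p"]) (simp_all add: aug free_mod_def basis B0)
    then show ?thesis by (auto simp: aug quot_def)
  qed
  have ker: "{V \<in> free_mod G 0. augmentation G M \<epsilon> V = M} = differential G 1 ` free_mod G 1"
  proof -
    have "lookup V e0 \<in> M \<longleftrightarrow> V \<in> differential G (Suc 0) ` free_mod G (Suc 0)" if V: "V \<in> free_mod G 0" for V
    proof -
      have strand0: "strand 0 a V = single e0 (lookup (lookup V e0) a)" for a
        by (rule poly_mapping_eqI) (auto simp: lookup_strand basis B0 lab_e0 lookup_single when_def)
      \<comment> \<open>In a multidegree of \<open>M\<close> everything in degree 0 is hit; in any
        other one only zero is.\<close>
      have "(\<exists>w. keys w \<subseteq> below a (Suc 0) \<and> scalar_diff (basis G) c (Suc 0) w = strand 0 a V)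
          \<longleftrightarrow> (lookup (lookup V e0) a \<noteq> 0 \<longrightarrow> monom_poly a \<in> M)" for a
      proof (cases "monom_poly a \<in> M")
        case True
        have "keys (strand 0 a V) \<subseteq> below a 0" by (rule keys_strand)
        then show ?thesis using exact[OF True] True unfolding exact_on_def basis by blast
      next
        case False
        have "below a (Suc 0) = {}"
          using False lab_in_ideal monomial_ideal_dvd[OF M] by (auto simp: basis)
        then have "keys w \<subseteq> below a (Suc 0) \<longleftrightarrow> w = 0" for w :: "'b \<Rightarrow>\<^sub>0 'k"
          by (simp only: subset_empty keys_eq_empty)
        then have "(\<exists>w. keys w \<subseteq> below a (Suc 0) \<and> scalar_diff (basis G) c (Suc 0) w = strand 0 a V)
            \<longleftrightarrow> single e0 (lookup (lookup V e0) a) = 0"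
          by (auto simp: strand0 additive.zero[OF additive_scalar_diff])
        moreover have "single e0 r = 0 \<longleftrightarrow> r = 0" for r :: 'k
          by (simp flip: keys_eq_empty)
        ultimately show ?thesis using False by simp
      qed
      then show ?thesis
        unfolding in_image_differential_iff[OF V] by (subst monomial_ideal_iff[OF M]) (auto simp: in_keys_iff)
    qed
    moreover have "differential G (Suc 0) V \<in> free_mod G 0" for V by (rule differential_free_mod)
    ultimately show ?thesis by (auto simp: aug coset_eq_ideal_iff[OF M])
  qed
  have ex: "{V \<in> free_mod G (Suc i). differential G (Suc i) V = 0}
      = differential G (Suc (Suc i)) ` free_mod G (Suc (Suc i))" for i
  proof -
    have below_empty: "below a (Suc j) = {}" if "monom_poly a \<notin> M" for a j
      using that lab_in_ideal monomial_ideal_dvd[OF M] by (auto simp: basis)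
    have "V \<in> differential G (Suc (Suc i)) ` free_mod G (Suc (Suc i))"
      if V: "V \<in> free_mod G (Suc i)" "differential G (Suc i) V = 0" for V
      unfolding in_image_differential_iff[OF V(1)]
    proof
      fix a
      show "\<exists>w. keys w \<subseteq> below a (Suc (Suc i)) \<and> scalar_diff (basis G) c (Suc (Suc i)) w = strand (Suc i) a V"
      proof (cases "monom_poly a \<in> M")
        case True
        have "keys (strand (Suc i) a V) \<subseteq> below a (Suc i)" by (rule keys_strand)
        moreover have "scalar_diff B c (Suc i) (strand (Suc i) a V) = 0"
          using V(2) differential_eq_0_iff basis by simp
        ultimately show ?thesis using exact[OF True] unfolding exact_on_def basis by blast
      next
        case False
        then have "strand (Suc i) a V = 0"
          using keys_strand[of "Suc i" a V] below_empty by simp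
        then show ?thesis by (intro exI[of _ 0]) (simp add: additive.zero[OF additive_scalar_diff])
      qed
    qed
    moreover have "differential G (Suc i) (differential G (Suc (Suc i)) W) = 0" for W
      by (simp add: differential_eq_0_iff strand_differential basis scalar_diff_scalar_diff)
    ultimately show ?thesis using differential_free_mod by blast
  qed
  have minimal: "lookup (differential G (Suc i) V) e' \<in> irrelevant_ideal" if e': "e' \<in> basis G i" for i V e'
  proof -
    have "lookup (lookup V e * entry G (Suc i) e e') 0 = 0" if e: "e \<in> basis G (Suc i)" for e
    proof (rule times_irrelevant_ideal)
      show "lookup (entry G (Suc i) e e') 0 = 0"
      proof (cases "c (Suc i) e e' = 0")
        case False
        then have "mono_sdvd (lab i e') (lab (Suc i) e)" using c_sdvd e e' basis by simp
        then have "lab (Suc i) e - lab i e' \<noteq> 0"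
          by (auto simp: mono_sdvd_def mono_dvd_diff_zero_iff)
        then show ?thesis by (simp add: entry_eq[OF e e'] lookup_single when_def)
      qed (simp add: entry_eq[OF e e'])
    qed
    then show ?thesis
      using e' by (simp add: irrelevant_ideal_iff lookup_differential[OF finite_basis] lookup_sum)
  qed
  have "free_resolution G M"
    unfolding free_resolution_def
    by (intro conjI exI[of _ \<epsilon>]) (rule homog hom0 surj ker ex allI)+
  then show ?thesis
    unfolding minimal_free_resolution_def by (intro conjI allI ballI minimal)
qed

theorem theorem2p1:
  fixes M :: "('x::finite, 'k::field) mpoly set"
    and N :: "('y::finite, 'k) mpoly set"
    and g :: "'x mono \<Rightarrow> 'y mono"
    and F :: "('b, 'x, 'k) based_seq"
  assumes "monomial_ideal M" and "monomial_ideal N"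
    and "M = UNIV \<longleftrightarrow> N = UNIV"
    and "poset_iso mono_dvd (betti_poset M) mono_dvd (betti_poset N) g"
    and "minimal_free_resolution F M"
  shows "minimal_free_resolution (relabel g F) N"
proof (cases "M = UNIV")
  case True
  \<comment> \<open>The zero ideal and the unit ideal have the same Betti poset; the third
    hypothesis keeps them apart. Here both ideals are the unit ideal and both resolutions are
    zero.\<close>
  have "basis F i = {}" for i by (rule resolution_of_unit_ideal[OF assms(5) True])
  then have basis: "basis (relabel g F) i = {}" for i by (simp add: relabel_def)
  then have fm: "free_mod (relabel g F) i = {0}" for i by (auto simp: free_mod_def)
  have d: "differential (relabel g F) i V = 0" for i V by (simp add: differential_def basis)
  have N: "N = UNIV" using True assms(3) by simp
  have coset: "coset N p = N" for p unfolding N coset_def by (metis surj_plus)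
  show ?thesis
    unfolding minimal_free_resolution_def free_resolution_def graded_free_seq_def
    by (auto simp: basis fm d augmentation_def coset quot_def)
next
  case False
  then have N: "N \<noteq> UNIV" using assms(3) by simp
  obtain e0 where "multigraded_resolution (basis F) (struct_coeff F) e0 (\<lambda>i e. mono_of (mdeg F i e)) M"
    using resolution_multigraded[OF assms(5,1) False] by blast
  from multigraded_resolution.relabel_multigraded_resolution[OF this assms(2) N assms(4)]
  show ?thesis
    by (rule multigraded_resolution.minimal_free_resolutionI) (simp_all add: relabel_def)
qed

end
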